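(* Let $k\geq 2$ and $n\geq 3(k-1)$ be integers. Suppose that $\mathcal F,\mathcal G\subset\binom{[n]}{k}$ are cross $2$-intersecting families, i.e. $|F\cap G|\geq 2$ for all $F\in\mathcal F$ and $G\in\mathcal G$. Then $|\mathcal F||\mathcal G|\leq\binom{n-2}{k-2}^2$. Moreover, if $|\mathcal F||\mathcal G|=\binom{n-2}{k-2}^2$, then the following hold: (1) If $n>3(k-1)$, then there exists a $2$-element subset $T\subset[n]$ such that $\mathcal F=\mathcal G=\mathcal F_0(T)$, where $\mathcal F_0(T):=\{F\in\binom{[n]}{k}:T\subset F\}$. (2) If $n=3(k-1)$, then either there exists a $2$-element subset $T\subset[n]$ such that $\mathcal F=\mathcal G=\mathcal F_0(T)$, or there exists a $4$-element subset $T'\subset[n]$ such that $\mathcal F=\mathcal G=\{F\in\binom{[n]}{k}:|F\cap T'|\geq 3\}$.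
   Context: $[n]=\{1,\dots,n\}$ and $\binom{[n]}{k}$ denotes the set of all $k$-element subsets of $[n]$. *)

theory Defs
  imports Main "HOL-Library.Ramsey"
begin

definition cross_intersecting :: "nat \<Rightarrow> 'a set set \<Rightarrow> 'a set set \<Rightarrow> bool" where
  "cross_intersecting t \<F> \<G> \<longleftrightarrow> (\<forall>F\<in>\<F>. \<forall>G\<in>\<G>. t \<le> card (F \<inter> G))"

definition star_family :: "nat \<Rightarrow> nat \<Rightarrow> nat set \<Rightarrow> nat set set" where
  "star_family n k T = {F \<in> nsets {1..n} k. T \<subseteq> F}"

end

theory Submission
  imports Defs
begin

text \<open>Take a pair of families whose product of sizes is maximal and shift it until it is stable. Let
\<open>m\<close> be least such that the traces on \<open>{1..m}\<close> are still cross 2-intersecting; then the families are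
exactly the liftings of the up-sets of these traces. If \<open>m = 2\<close>, both families are stars. If
\<open>m \<ge> 3\<close>, some traces \<open>A\<close>, \<open>B\<close> meet in two points, one of them \<open>m\<close>, and stability forces
\<open>A \<union> B = {1..m}\<close>, so the sizes \<open>i\<close>, \<open>j\<close> of such \<open>A\<close>, \<open>B\<close> satisfy \<open>i + j = m + 2\<close>. Deleting \<open>m\<close> from
all the critical traces of size \<open>i\<close> on one side costs the critical traces of size \<open>j\<close> on the other side,
and conversely. That neither of the two exchanges increases the product forces the critical
traces of size \<open>i\<close> to carry a large proportion of their family, whereas shifting \<open>m\<close> downwards and
counting upper shadows twice shows that they carry a small one. For \<open>i \<le> j\<close> the two bounds are incompatible
except for \<open>(i, j)\<close> among \<open>(2, 3)\<close>, \<open>(3, 3)\<close>, \<open>(4, 4)\<close>, where the traces on 3, 4 and 6 points are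
estimated directly; the case of 4 points yields the second extremal family when \<open>n = 3 (k - 1)\<close>. Finally an
extremal structure is pulled back through each shift.\<close>

section \<open>Shifting\<close>

definition swap_in :: "'a \<Rightarrow> 'a \<Rightarrow> 'a set \<Rightarrow> 'a set" where
  "swap_in i j A = insert i (A - {j})"

text \<open>A set stays put when its image is already a member; this makes the map injective on the
  family, so shifting preserves sizes.\<close>

definition shift_elem :: "'a \<Rightarrow> 'a \<Rightarrow> 'a set set \<Rightarrow> 'a set \<Rightarrow> 'a set" where
  "shift_elem i j \<F> A =
    (if j \<in> A \<and> i \<notin> A \<and> swap_in i j A \<notin> \<F> then swap_in i j A else A)"

definition shift :: "'a \<Rightarrow> 'a \<Rightarrow> 'a set set \<Rightarrow> 'a set set" where
  "shift i j \<F> = shift_elem i j \<F> ` \<F>"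

lemma swap_in_inject:
  assumes "j \<in> A" "i \<notin> A" "j \<in> B" "i \<notin> B" "swap_in i j A = swap_in i j B"
  shows "A = B"
proof -
  have *: "C = insert j (swap_in i j C - {i})" if "j \<in> C" "i \<notin> C" for C
    using that by (auto simp: swap_in_def)
  show ?thesis using *[of A] *[of B] assms by simp
qed

lemma card_swap_in: "finite A \<Longrightarrow> j \<in> A \<Longrightarrow> i \<notin> A \<Longrightarrow> card (swap_in i j A) = card A"
  using card_Suc_Diff1[of A j] by (simp add: swap_in_def del: card_Diff_insert card_Suc_Diff1)

lemma swap_in_mem_nsets:
  "A \<in> nsets X k \<Longrightarrow> j \<in> A \<Longrightarrow> i \<notin> A \<Longrightarrow> i \<in> X \<Longrightarrow> swap_in i j A \<in> nsets X k"
  using card_swap_in[of A j i] by (auto simp: nsets_def swap_in_def)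

lemma inj_on_shift_elem: "inj_on (shift_elem i j \<F>) \<F>"
proof (rule inj_onI)
  fix A B assume "A \<in> \<F>" "B \<in> \<F>" "shift_elem i j \<F> A = shift_elem i j \<F> B"
  then show "A = B"
    unfolding shift_elem_def using swap_in_inject[of j A i B] by (auto split: if_splits)
qed

lemma card_shift: "card (shift i j \<F>) = card \<F>"
  unfolding shift_def by (rule card_image[OF inj_on_shift_elem])

lemma shift_subset_nsets: "\<F> \<subseteq> nsets X k \<Longrightarrow> i \<in> X \<Longrightarrow> shift i j \<F> \<subseteq> nsets X k"
  by (auto simp: shift_def shift_elem_def intro!: swap_in_mem_nsets)

lemma mem_shift_cases:
  assumes "A \<in> shift i j \<F>"
  obtains "A \<in> \<F>" "j \<in> A \<Longrightarrow> i \<notin> A \<Longrightarrow> swap_in i j A \<in> \<F>"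
  | B where "B \<in> \<F>" "j \<in> B" "i \<notin> B" "A = swap_in i j B" "A \<notin> \<F>"
  using assms by (auto simp: shift_def shift_elem_def split: if_splits)

lemma mem_imp_shift:
  assumes "A \<in> \<F>"
  obtains "A \<in> shift i j \<F>" | "j \<in> A" "i \<notin> A" "swap_in i j A \<in> shift i j \<F>"
proof (cases "shift_elem i j \<F> A = A")
  case True
  then show ?thesis using that(1) assms unfolding shift_def by (metis imageI)
next
  case False
  then have "j \<in> A" "i \<notin> A" "shift_elem i j \<F> A = swap_in i j A"
    by (auto simp: shift_elem_def split: if_splits)
  then show ?thesis using that(2) assms unfolding shift_def by (metis imageI)
qed

section \<open>Shifting both families preserves cross-intersection\<close>

lemma cross_intersecting_commute: "cross_intersecting t \<F> \<G> \<longleftrightarrow> cross_intersecting t \<G> \<F>"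
  unfolding cross_intersecting_def by (metis Int_commute)

lemma card_Int_swap_in_le:
  assumes "finite A0" "j \<in> A0" "i \<notin> A0" "j \<notin> B \<or> i \<in> B"
  shows "card (A0 \<inter> B) \<le> card (swap_in i j A0 \<inter> B)"
proof (cases "j \<in> B")
  case True
  then have "swap_in i j A0 \<inter> B = swap_in i j (A0 \<inter> B)"
    using assms by (auto simp: swap_in_def)
  then show ?thesis using card_swap_in[of "A0 \<inter> B" j i] assms True by simp
next
  case False
  then have "A0 \<inter> B \<subseteq> swap_in i j A0 \<inter> B" by (auto simp: swap_in_def)
  then show ?thesis using assms by (intro card_mono) (auto simp: swap_in_def)
qed

text \<open>Replacing \<open>j\<close> by \<open>i\<close> in \<open>A0\<close> can only hurt when
  \<open>B\<close> contains \<open>j\<close> but not \<open>i\<close>. Such a \<open>B\<close>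
  survived the shift because \<open>swap_in i j B\<close> already lies in \<open>\<G>\<close>, and
  that set meets \<open>A0\<close> in exactly the required intersection.\<close>

lemma cross_shift_moved:
  assumes X: "cross_intersecting t \<F> \<G>" and fin: "\<And>A. A \<in> \<F> \<Longrightarrow> finite A"
    and A: "A0 \<in> \<F>" "j \<in> A0" "i \<notin> A0" and B: "B \<in> shift i j \<G>"
  shows "t \<le> card (swap_in i j A0 \<inter> B)"
  using B
proof (cases rule: mem_shift_cases)
  case 1
  show ?thesis
  proof (cases "j \<notin> B \<or> i \<in> B")
    case True
    then show ?thesis
      using card_Int_swap_in_le[of A0 j i B] A fin[OF A(1)] X 1(1)
      unfolding cross_intersecting_def by (meson order_trans)
  next
    case False
    then have "swap_in i j A0 \<inter> B = A0 \<inter> swap_in i j B" using A by (auto simp: swap_in_def)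
    then show ?thesis using 1(2) False X A(1) by (auto simp: cross_intersecting_def)
  qed
next
  case (2 B0)
  have "swap_in i j A0 \<inter> B = swap_in i j (A0 \<inter> B0)" using A 2 by (auto simp: swap_in_def)
  then show ?thesis using card_swap_in[of "A0 \<inter> B0" j i] A 2 X fin[OF A(1)]
    by (auto simp: cross_intersecting_def)
qed

lemma cross_intersecting_shift:
  assumes X: "cross_intersecting t \<F> \<G>" and fin: "\<And>A. A \<in> \<F> \<union> \<G> \<Longrightarrow> finite A"
  shows "cross_intersecting t (shift i j \<F>) (shift i j \<G>)"
  unfolding cross_intersecting_def
proof (intro ballI)
  fix A B assume AB: "A \<in> shift i j \<F>" "B \<in> shift i j \<G>"
  from AB(1) show "t \<le> card (A \<inter> B)"
  proof (cases rule: mem_shift_cases)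
    case A: 1
    from AB(2) show ?thesis
    proof (cases rule: mem_shift_cases)
      case 1
      then show ?thesis using A X by (auto simp: cross_intersecting_def)
    next
      case (2 B0)
      then show ?thesis
        using cross_shift_moved[of t \<G> \<F> B0 j i A] X fin AB(1)
        by (metis Int_commute UnCI cross_intersecting_commute)
    qed
  next
    case (2 A0)
    then show ?thesis using cross_shift_moved[of t \<F> \<G> A0 j i B] X fin AB(2) by simp
  qed
qed

section \<open>Stable families, and a potential that makes repeated shifting terminate\<close>

definition shifted :: "nat set set \<Rightarrow> bool" where
  "shifted \<F> \<longleftrightarrow> (\<forall>A\<in>\<F>. \<forall>i j. 1 \<le> i \<longrightarrow> i < j \<longrightarrow> j \<in> A \<longrightarrow> i \<notin> A \<longrightarrow> swap_in i j A \<in> \<F>)"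

definition weight :: "nat set set \<Rightarrow> nat" where
  "weight \<F> = (\<Sum>A\<in>\<F>. \<Sum>A)"

lemma sum_swap_in_less:
  fixes A :: "nat set"
  assumes "finite A" "j \<in> A" "i \<notin> A" "i < j"
  shows "\<Sum>(swap_in i j A) < \<Sum>A"
  using assms by (simp add: swap_in_def sum.remove[of A j])

lemma sum_shift_elem_le:
  fixes A :: "nat set"
  assumes "finite A" "i < j"
  shows "\<Sum>(shift_elem i j \<F> A) \<le> \<Sum>A"
  using sum_swap_in_less[of A j i] assms by (auto simp: shift_elem_def)

lemma weight_shift: "weight (shift i j \<F>) = (\<Sum>A\<in>\<F>. \<Sum>(shift_elem i j \<F> A))"
  unfolding weight_def shift_def by (simp add: sum.reindex[OF inj_on_shift_elem])

lemma weight_shift_le: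
  assumes "\<And>A. A \<in> \<F> \<Longrightarrow> finite A" "i < j"
  shows "weight (shift i j \<F>) \<le> weight \<F>"
  unfolding weight_shift using assms by (auto simp: weight_def intro!: sum_mono sum_shift_elem_le)

lemma weight_shift_less:
  assumes "finite \<F>" "\<And>A. A \<in> \<F> \<Longrightarrow> finite A" "i < j"
    "A \<in> \<F>" "j \<in> A" "i \<notin> A" "swap_in i j A \<notin> \<F>"
  shows "weight (shift i j \<F>) < weight \<F>"
  unfolding weight_shift unfolding weight_def
proof (rule sum_strict_mono_ex1)
  show "\<exists>A\<in>\<F>. \<Sum>(shift_elem i j \<F> A) < \<Sum>A"
    using assms by (intro bexI[of _ A]) (auto simp: shift_elem_def intro!: sum_swap_in_less)
qed (use assms sum_shift_elem_le in auto)

text \<open>One form for both extremal structures: threshold 2 on a core of 2 points gives a star,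
  threshold 3 on a core of 4 points gives the second family.\<close>

definition core_family :: "nat \<Rightarrow> nat \<Rightarrow> nat set \<Rightarrow> nat \<Rightarrow> nat set set" where
  "core_family n k T r = {F \<in> nsets {1..n} k. r \<le> card (F \<inter> T)}"

lemma finite_core_family [simp]: "finite (core_family n k T r)"
  by (simp add: core_family_def finite_imp_finite_nsets)

lemma card_swap_in_Int:
  assumes "finite A" "j \<in> A" "i \<notin> A"
  shows "card (swap_in i j A \<inter> T) + (if j \<in> T then 1 else 0) = card (A \<inter> T) + (if i \<in> T then 1 else 0)"
proof -
  have "A \<inter> T = (if j \<in> T then insert j ((A - {j}) \<inter> T) else (A - {j}) \<inter> T)" using assms by auto
  then have 1: "card (A \<inter> T) = card ((A - {j}) \<inter> T) + (if j \<in> T then 1 else 0)"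
    using assms by (simp split: if_splits)
  have "swap_in i j A \<inter> T = (if i \<in> T then insert i ((A - {j}) \<inter> T) else (A - {j}) \<inter> T)"
    by (auto simp: swap_in_def)
  then have 2: "card (swap_in i j A \<inter> T) = card ((A - {j}) \<inter> T) + (if i \<in> T then 1 else 0)"
    using assms by (simp split: if_splits)
  from 1 2 show ?thesis by simp
qed

section \<open>Undoing a shift\<close>

lemma swap_in_insert: "i \<notin> C \<Longrightarrow> j \<notin> C \<Longrightarrow> swap_in i j (insert j C) = insert i C"
  by (auto simp: swap_in_def)

text \<open>The shift from \<open>j\<close> to \<open>i\<close> carries the family over the
  exchanged core into the family over \<open>T\<close>, and shifting preserves sizes.\<close>

lemma card_core_family_swap_le:
  assumes ij: "i \<in> T" "j \<notin> T" and T: "T \<subseteq> {1..n}"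
  shows "card (core_family n k (swap_in j i T) r) \<le> card (core_family n k T r)"
proof -
  let ?T = "swap_in j i T"
  have "shift i j (core_family n k ?T r) \<subseteq> core_family n k T r"
  proof
    fix A assume "A \<in> shift i j (core_family n k ?T r)"
    then show "A \<in> core_family n k T r"
    proof (cases rule: mem_shift_cases)
      case 1
      then have A: "A \<in> nsets {1..n} k" "r \<le> card (A \<inter> ?T)" by (auto simp: core_family_def)
      then have fin: "finite A" by (simp add: nsets_def)
      have "r \<le> card (A \<inter> T)"
      proof (cases "i \<in> A")
        case True
        then have "A \<inter> T = insert i (A \<inter> (T - {i}))" using ij by auto
        then have "card (A \<inter> T) = Suc (card (A \<inter> (T - {i})))" using fin by simp
        moreover have "A \<inter> ?T \<subseteq> insert j (A \<inter> (T - {i}))" by (auto simp: swap_in_def)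
        then have "card (A \<inter> ?T) \<le> card (insert j (A \<inter> (T - {i})))" using fin by (intro card_mono) auto
        moreover have "card (insert j (A \<inter> (T - {i}))) \<le> Suc (card (A \<inter> (T - {i})))"
          using fin by (simp add: card_insert_if)
        ultimately show ?thesis using A by linarith
      next
        case i: False
        show ?thesis
        proof (cases "j \<in> A")
          case True
          then have "r \<le> card (swap_in i j A \<inter> ?T)" using 1 i by (auto simp: core_family_def)
          also have "swap_in i j A \<inter> ?T \<subseteq> A \<inter> T" using ij i by (auto simp: swap_in_def)
          then have "card (swap_in i j A \<inter> ?T) \<le> card (A \<inter> T)" using fin by (intro card_mono) auto
          finally show ?thesis .
        next
          case False
          then have "A \<inter> ?T \<subseteq> A \<inter> T" by (auto simp: swap_in_def)
          then have "card (A \<inter> ?T) \<le> card (A \<inter> T)" using fin by (intro card_mono) auto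
          then show ?thesis using A by linarith
        qed
      qed
      then show ?thesis using A by (simp add: core_family_def)
    next
      case (2 B)
      then have B: "B \<in> nsets {1..n} k" "r \<le> card (B \<inter> ?T)" by (auto simp: core_family_def)
      then have fin: "finite B" by (simp add: nsets_def)
      have "swap_in i j B \<inter> T = swap_in i j (B \<inter> ?T)" using ij 2 by (auto simp: swap_in_def)
      then have "card (A \<inter> T) = card (B \<inter> ?T)"
        using card_swap_in[of "B \<inter> ?T" j i] 2 fin by (auto simp: swap_in_def)
      moreover have "A \<in> nsets {1..n} k"
        using swap_in_mem_nsets[OF B(1) 2(2,3)] 2(4) ij T by auto
      ultimately show ?thesis using B by (simp add: core_family_def)
    qed
  qed
  then have "card (shift i j (core_family n k ?T r)) \<le> card (core_family n k T r)"
    by (intro card_mono) auto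
  then show ?thesis by (simp add: card_shift)
qed

text \<open>The cores \<open>C\<close> for which the threshold condition holds for \<open>insert i C\<close> but fails for
  \<open>insert j C\<close>, where \<open>i \<in> T\<close> and \<open>j \<notin> T\<close>.\<close>

definition split_core :: "nat \<Rightarrow> nat \<Rightarrow> nat set \<Rightarrow> nat \<Rightarrow> nat \<Rightarrow> nat \<Rightarrow> nat set \<Rightarrow> bool" where
  "split_core n k T r i j C \<longleftrightarrow> C \<in> nsets ({1..n} - {i, j}) (k - 1) \<and> card (C \<inter> T) = r - 1"

text \<open>The only constellation in which the shift can hide a change of core: a shifted family
  with core \<open>T\<close> may have had core \<open>T\<close> or the exchanged core
  before.\<close>

locale unshift =
  fixes n k r i j :: nat and T :: "nat set"
  assumes k1: "k \<ge> 1" and r1: "r \<ge> 1"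
    and ij: "i \<in> T" "j \<notin> T" "i \<in> {1..n}" "j \<in> {1..n}" and T: "T \<subseteq> {1..n}"
begin

abbreviation "T' \<equiv> swap_in j i T"
abbreviation "split \<equiv> split_core n k T r i j"

text \<open>\<open>insert i C\<close> reaches the threshold and so lies in the shifted family; the
  only other set that can have been moved onto it is \<open>insert j C\<close>.\<close>

lemma split_insert_mem:
  assumes C: "split C" and F: "shift i j \<F> = core_family n k T r"
  shows "insert i C \<in> \<F> \<or> insert j C \<in> \<F>"
proof -
  have C': "i \<notin> C" "j \<notin> C" "finite C" "card C = k - 1" "C \<subseteq> {1..n}" "card (C \<inter> T) = r - 1"
    using C by (auto simp: split_core_def nsets_def)
  have "insert i C \<inter> T = insert i (C \<inter> T)" using ij by auto
  then have "insert i C \<in> core_family n k T r"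
    using C' k1 r1 ij by (auto simp: core_family_def nsets_def)
  then have "insert i C \<in> shift i j \<F>" using F by simp
  then show ?thesis
  proof (cases rule: mem_shift_cases)
    case (2 B)
    then have "swap_in i j (insert j C) = swap_in i j B" using C' by (simp add: swap_in_insert)
    then have "insert j C = B" using swap_in_inject[of j "insert j C" i B] 2 C' ij by auto
    then show ?thesis using 2 by auto
  qed simp
qed

lemma split_of_mem:
  assumes A: "A \<in> nsets {1..n} k" and c: "c \<in> A" "{c, d} = {i, j}" "d \<notin> A"
    and r: "card ((A - {c}) \<inter> T) = r - 1"
  shows "\<exists>C. split C \<and> A = insert c C"
proof (intro exI conjI)
  show "split (A - {c})"
    unfolding split_core_def using A c r by (auto simp: nsets_def doubleton_eq_iff)
  show "A = insert c (A - {c})" using c by auto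
qed

text \<open>Such a member must have been moved, and the move adds a single point of
  \<open>T\<close>; crossing the threshold by it leaves exactly \<open>r - 1\<close> core
  points.\<close>

lemma not_mem_core_family:
  assumes A: "A \<in> \<F>" "A \<notin> core_family n k T r" and sub: "\<F> \<subseteq> nsets {1..n} k"
    and F: "shift i j \<F> = core_family n k T r"
  shows "\<exists>C. split C \<and> A = insert j C"
proof -
  have An: "A \<in> nsets {1..n} k" using A sub by auto
  then have fin: "finite A" by (simp add: nsets_def)
  have m: "j \<in> A" "i \<notin> A" "swap_in i j A \<in> core_family n k T r"
    using mem_imp_shift[OF A(1), of i j thesis for thesis] A(2) F by auto
  have "card (swap_in i j A \<inter> T) = card (A \<inter> T) + 1"
    using card_swap_in_Int[OF fin m(1,2), of T] ij by simp
  moreover have "card (A \<inter> T) < r" using A(2) An by (auto simp: core_family_def)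
  moreover have "r \<le> card (swap_in i j A \<inter> T)" using m by (simp add: core_family_def)
  moreover have "(A - {j}) \<inter> T = A \<inter> T" using ij by auto
  ultimately have "card ((A - {j}) \<inter> T) = r - 1" by simp
  then show ?thesis using split_of_mem[OF An, of j i] m by auto
qed

text \<open>Here the member cannot have been moved: the move would turn its intersection with
  \<open>T'\<close> into one with \<open>T\<close> of the same size. So it reaches the threshold on
  \<open>T\<close> but not on \<open>T'\<close>, which forces it to contain \<open>i\<close>, to
  avoid \<open>j\<close> and to have no core point to spare.\<close>

lemma not_mem_core_family_swap:
  assumes A: "A \<in> \<F>" "A \<notin> core_family n k T' r" and sub: "\<F> \<subseteq> nsets {1..n} k"
    and F: "shift i j \<F> = core_family n k T r"
  shows "\<exists>C. split C \<and> A = insert i C"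
proof -
  have An: "A \<in> nsets {1..n} k" using A sub by auto
  then have fin: "finite A" by (simp add: nsets_def)
  have lt: "card (A \<inter> T') < r" using A(2) An by (auto simp: core_family_def)
  have AT: "A \<in> core_family n k T r"
  proof (rule ccontr)
    assume n: "A \<notin> core_family n k T r"
    then have m: "j \<in> A" "i \<notin> A" "swap_in i j A \<in> core_family n k T r"
      using mem_imp_shift[OF A(1), of i j thesis for thesis] F by auto
    have "swap_in i j A \<inter> T = swap_in i j (A \<inter> T')" using m ij by (auto simp: swap_in_def)
    then have "card (swap_in i j A \<inter> T) = card (A \<inter> T')"
      using card_swap_in[of "A \<inter> T'" j i] m fin by (auto simp: swap_in_def)
    then show False using m(3) lt by (auto simp: core_family_def)
  qed
  then have ge: "r \<le> card (A \<inter> T)" by (simp add: core_family_def)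
  have sub': "(A - {i}) \<inter> T \<subseteq> A \<inter> T'" by (auto simp: swap_in_def)
  then have le1: "card ((A - {i}) \<inter> T) \<le> card (A \<inter> T')" using fin by (intro card_mono) auto
  have iA: "i \<in> A"
  proof (rule ccontr)
    assume "i \<notin> A"
    then have "A - {i} = A" by auto
    then show False using le1 lt ge by simp
  qed
  then have eq: "A \<inter> T = insert i ((A - {i}) \<inter> T)" using ij by auto
  have cA: "card (A \<inter> T) = Suc (card ((A - {i}) \<inter> T))" unfolding eq using fin by simp
  have jA: "j \<notin> A"
  proof
    assume "j \<in> A"
    then have "insert j ((A - {i}) \<inter> T) \<subseteq> A \<inter> T'" by (auto simp: swap_in_def)
    then have "card (insert j ((A - {i}) \<inter> T)) \<le> card (A \<inter> T')" using fin by (intro card_mono) auto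
    then show False using ij cA lt ge fin by simp
  qed
  have "card ((A - {i}) \<inter> T) = r - 1" using cA le1 lt ge by linarith
  then show ?thesis using split_of_mem[OF An, of i j] iA jA by auto
qed

text \<open>If \<open>B\<close> and \<open>C\<close> are nearly disjoint, \<open>insert i B\<close> and \<open>insert j C\<close> cannot lie on opposite
  sides; so all split cores are completed by the same one of the two points.\<close>

lemma split_uniform:
  assumes sep: "\<And>C D. split C \<Longrightarrow> split D \<Longrightarrow> \<exists>B. split B \<and> card (B \<inter> C) \<le> 1 \<and> card (B \<inter> D) \<le> 1"
    and X: "cross_intersecting 2 \<F> \<G>"
    and F: "shift i j \<F> = core_family n k T r" and G: "shift i j \<G> = core_family n k T r"
    and C: "split C" "insert j C \<in> \<F>" and D: "split D" "insert i D \<in> \<F> \<union> \<G>"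
  shows False
proof -
  have small: False if "split B" "split C" "card (B \<inter> C) \<le> 1"
    "insert i B \<in> \<F> \<and> insert j C \<in> \<G> \<or> insert j B \<in> \<F> \<and> insert i C \<in> \<G>" for B C
  proof -
    have "i \<noteq> j" using ij by auto
    then have eq: "insert i B \<inter> insert j C = B \<inter> C" "insert j B \<inter> insert i C = B \<inter> C"
      using that ij by (auto simp: split_core_def nsets_def)
    from that(4) show False
    proof (elim disjE conjE)
      assume "insert i B \<in> \<F>" "insert j C \<in> \<G>"
      then have "2 \<le> card (B \<inter> C)" using X eq(1) unfolding cross_intersecting_def by metis
      then show False using that(3) by linarith
    next
      assume "insert j B \<in> \<F>" "insert i C \<in> \<G>"
      then have "2 \<le> card (B \<inter> C)" using X eq(2) unfolding cross_intersecting_def by metis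
      then show False using that(3) by linarith
    qed
  qed
  \<comment> \<open>However the separating set \<open>B\<close> is completed in \<open>\<G>\<close>,
    the completion meets \<open>insert j C\<close> or \<open>insert i E\<close> in at most one
    point.\<close>
  have step: False if E: "split E" "insert i E \<in> \<F>" for E
  proof -
    obtain B where B: "split B" "card (B \<inter> C) \<le> 1" "card (B \<inter> E) \<le> 1"
      using sep[OF C(1) E(1)] by (elim exE conjE)
    then have B': "card (C \<inter> B) \<le> 1" "card (E \<inter> B) \<le> 1" by (simp_all add: Int_commute)
    from split_insert_mem[OF B(1) G] show False
    proof
      assume "insert i B \<in> \<G>"
      with C(2) have "insert i C \<in> \<F> \<and> insert j B \<in> \<G> \<or> insert j C \<in> \<F> \<and> insert i B \<in> \<G>" by simp
      from small[OF C(1) B(1) B'(1) this] show False .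
    next
      assume "insert j B \<in> \<G>"
      with E(2) have "insert i E \<in> \<F> \<and> insert j B \<in> \<G> \<or> insert j E \<in> \<F> \<and> insert i B \<in> \<G>" by simp
      from small[OF E(1) B(1) B'(2) this] show False .
    qed
  qed
  show False
  proof (cases "insert i D \<in> \<F>")
    case True
    then show ?thesis by (rule step[OF D(1)])
  next
    case False
    then have DG: "insert i D \<in> \<G>" using D by blast
    \<comment> \<open>Now \<open>insert i D\<close> lies in \<open>\<G>\<close> only, so
      \<open>B\<close> is completed in \<open>\<F>\<close>: by \<open>i\<close> the previous step
      applies, by \<open>j\<close> there is a conflict with \<open>insert i D\<close>.\<close>
    obtain B where B: "split B" "card (B \<inter> D) \<le> 1" using sep[OF D(1) D(1)] by (elim exE conjE)
    from split_insert_mem[OF B(1) F] show False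
    proof
      assume "insert i B \<in> \<F>"
      then show False by (rule step[OF B(1)])
    next
      assume "insert j B \<in> \<F>"
      with DG have "insert i B \<in> \<F> \<and> insert j D \<in> \<G> \<or> insert j B \<in> \<F> \<and> insert i D \<in> \<G>" by simp
      from small[OF B(1) D(1) B(2) this] show False .
    qed
  qed
qed

text \<open>A member outside the family of \<open>T\<close> yields a split core completed by
  \<open>j\<close>, one outside the family of \<open>T'\<close> a split core completed by
  \<open>i\<close>. Both cannot occur, and comparing sizes turns the remaining inclusion into
  equality.\<close>

lemma unshift_dichotomy:
  assumes sep: "\<And>C D. split C \<Longrightarrow> split D \<Longrightarrow> \<exists>B. split B \<and> card (B \<inter> C) \<le> 1 \<and> card (B \<inter> D) \<le> 1"
    and X: "cross_intersecting 2 \<F> \<G>" and sub: "\<F> \<subseteq> nsets {1..n} k" "\<G> \<subseteq> nsets {1..n} k"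
    and F: "shift i j \<F> = core_family n k T r" and G: "shift i j \<G> = core_family n k T r"
  shows "(\<F> = core_family n k T r \<and> \<G> = core_family n k T r) \<or>
    (\<F> = core_family n k T' r \<and> \<G> = core_family n k T' r)"
proof -
  have card: "card \<F> = card (core_family n k T r)" "card \<G> = card (core_family n k T r)"
    using F G card_shift by metis+
  have X': "cross_intersecting 2 \<G> \<F>" using X cross_intersecting_commute by blast
  have card': "card (core_family n k T' r) \<le> card (core_family n k T r)"
    by (rule card_core_family_swap_le) (use ij T in auto)
  show ?thesis
  proof (cases "\<F> \<union> \<G> \<subseteq> core_family n k T r")
    case True
    then show ?thesis using card by (metis card_subset_eq finite_core_family le_sup_iff)
  next
    case False
    then obtain A where "A \<in> \<F> \<union> \<G>" "A \<notin> core_family n k T r" by blast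
    then obtain C where C: "split C" "insert j C \<in> \<F> \<union> \<G>"
      using not_mem_core_family sub F G by (metis Un_iff)
    have "\<F> \<union> \<G> \<subseteq> core_family n k T' r"
    proof (rule ccontr)
      assume "\<not> ?thesis"
      then obtain A where "A \<in> \<F> \<union> \<G>" "A \<notin> core_family n k T' r" by blast
      then obtain D where "split D" "insert i D \<in> \<F> \<union> \<G>"
        using not_mem_core_family_swap sub F G by (metis Un_iff)
      then show False
        using split_uniform[OF sep X F G, of C D] split_uniform[OF sep X' G F, of C D] C by blast
    qed
    then show ?thesis using card card' by (metis card_seteq finite_core_family le_sup_iff)
  qed
qed

text \<open>\<open>B\<close> is built from the \<open>r - 1\<close> core points of \<open>Q\<close>
  and \<open>k - r\<close> fresh points. \<open>T\<close> and \<open>j\<close> occupy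
  \<open>card T + 1\<close> points, \<open>C\<close> and \<open>D\<close> at most
  \<open>2 * (k - r)\<close> further ones, so the bound on \<open>n\<close> leaves enough
  room.\<close>

lemma split_separated:
  assumes n: "card T + 1 + 3 * (k - r) \<le> n" and rk: "r \<le> k"
    and Q: "\<And>P P'. P \<in> nsets (T - {i}) (r - 1) \<Longrightarrow> P' \<in> nsets (T - {i}) (r - 1) \<Longrightarrow>
      \<exists>Q \<in> nsets (T - {i}) (r - 1). card (Q \<inter> P) \<le> 1 \<and> card (Q \<inter> P') \<le> 1"
    and CD: "split C" "split D"
  shows "\<exists>B. split B \<and> card (B \<inter> C) \<le> 1 \<and> card (B \<inter> D) \<le> 1"
proof -
  let ?S = "T - {i}"
  have finT: "finite T" using T finite_subset by blast
  then have "card T \<noteq> 0" using ij by auto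
  then have cS: "card ?S = card T - 1" "card T \<ge> 1" using ij by auto
  have cD: "finite E" "E \<inter> T = E \<inter> ?S" "card (E - ?S) = k - r" "E \<inter> ?S \<in> nsets ?S (r - 1)"
    if "split E" for E
  proof -
    have E: "finite E" "card E = k - 1" "card (E \<inter> T) = r - 1" "i \<notin> E"
      using that by (auto simp: split_core_def nsets_def)
    then show "finite E" "E \<inter> T = E \<inter> ?S" by auto
    then show "E \<inter> ?S \<in> nsets ?S (r - 1)" using E by (simp add: nsets_def)
    have "E - ?S = E - E \<inter> T" using E by auto
    then show "card (E - ?S) = k - r" using E r1 rk by (simp add: card_Diff_subset)
  qed
  obtain Q where Q: "Q \<in> nsets ?S (r - 1)" "card (Q \<inter> (C \<inter> ?S)) \<le> 1" "card (Q \<inter> (D \<inter> ?S)) \<le> 1"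
    using Q[OF cD(4) cD(4), OF CD] by blast
  let ?U = "{i, j} \<union> ?S \<union> (C - ?S) \<union> (D - ?S)"
  have "card ?U \<le> card ({i, j} \<union> ?S) + card (C - ?S) + card (D - ?S)"
    by (meson add_mono card_Un_le order_trans le_refl)
  also have "card ({i, j} \<union> ?S) \<le> card {i, j} + card ?S" by (rule card_Un_le)
  also have "card {i, j} = 2" using ij by (metis card_2_iff)
  finally have cU: "card ?U \<le> card T + 1 + 2 * (k - r)" using cS cD CD by simp
  have "card {1..n} - card ?U \<le> card ({1..n} - ?U)"
    by (rule diff_card_le_card_Diff) (use cD CD finT in auto)
  then have "k - r \<le> card ({1..n} - ?U)" using n cU by simp
  then obtain R where R: "R \<subseteq> {1..n} - ?U" "card R = k - r" "finite R"
    by (rule obtain_subset_with_card_n)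
  have Q': "Q \<subseteq> ?S" "finite Q" "card Q = r - 1" using Q by (auto simp: nsets_def)
  have disj: "Q \<inter> R = {}" using Q' R by auto
  have "(Q \<union> R) \<inter> C = Q \<inter> (C \<inter> ?S)" "(Q \<union> R) \<inter> D = Q \<inter> (D \<inter> ?S)" using Q' R by auto
  moreover have "(Q \<union> R) \<inter> T = Q" using Q' R by auto
  moreover have "card (Q \<union> R) = k - 1" using Q' R disj r1 rk by (simp add: card_Un_disjoint)
  moreover have "Q \<union> R \<subseteq> {1..n} - {i, j}" using Q' R ij T by blast
  ultimately have "split (Q \<union> R)" "card ((Q \<union> R) \<inter> C) \<le> 1" "card ((Q \<union> R) \<inter> D) \<le> 1"
    using Q Q' R by (simp_all add: split_core_def nsets_def)
  then show ?thesis by blast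
qed

end

text \<open>In this case the swap never enlarges the intersection with \<open>T\<close>, so a member
  whose swap reaches the threshold reaches it already.\<close>

lemma unshift_fixed:
  assumes F: "shift i j \<F> = core_family n k T r" and sub: "\<F> \<subseteq> nsets {1..n} k"
    and ij: "\<not> (i \<in> T \<and> j \<notin> T)"
  shows "\<F> = core_family n k T r"
proof -
  have "\<F> \<subseteq> core_family n k T r"
  proof
    fix A assume A: "A \<in> \<F>"
    then have An: "A \<in> nsets {1..n} k" using sub by auto
    from A show "A \<in> core_family n k T r"
    proof (rule mem_imp_shift[of _ _ i j])
      assume "A \<in> shift i j \<F>" then show ?thesis using F by simp
    next
      assume m: "j \<in> A" "i \<notin> A" "swap_in i j A \<in> shift i j \<F>"
      have "finite A" using An by (simp add: nsets_def)
      from card_swap_in_Int[OF this m(1,2), of T]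
      show ?thesis using ij m(3) F An by (auto simp: core_family_def split: if_splits)
    qed
  qed
  then show ?thesis using F card_shift by (metis card_subset_eq finite_core_family)
qed

text \<open>It remains to separate inside the core. For \<open>r = 2\<close> the singleton
  \<open>P\<close> does it; for \<open>r = 3\<close> a 3-set has three 2-subsets, and one different
  from \<open>P\<close> and \<open>P'\<close> meets each of them in at most one point.\<close>

lemma unshift_core_family:
  assumes X: "cross_intersecting 2 \<F> \<G>" and sub: "\<F> \<subseteq> nsets {1..n} k" "\<G> \<subseteq> nsets {1..n} k"
    and F: "shift i j \<F> = core_family n k T r" and G: "shift i j \<G> = core_family n k T r"
    and ij: "i \<in> {1..n}" "j \<in> {1..n}" and Tt: "T \<in> nsets {1..n} t"
    and n: "t + 1 + 3 * (k - r) \<le> n" and rk: "r \<le> k" and tr: "t = 2 \<and> r = 2 \<or> t = 4 \<and> r = 3"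
  shows "\<exists>T' \<in> nsets {1..n} t. \<F> = core_family n k T' r \<and> \<G> = core_family n k T' r"
proof (cases "i \<in> T \<and> j \<notin> T")
  case False
  then show ?thesis using unshift_fixed F G sub Tt by blast
next
  case True
  have T': "T \<subseteq> {1..n}" "finite T" "card T = t" using Tt by (auto simp: nsets_def)
  interpret unshift n k r i j T
    by unfold_locales (use True ij T' rk tr in auto)
  have sep: "\<exists>Q \<in> nsets (T - {i}) (r - 1). card (Q \<inter> P) \<le> 1 \<and> card (Q \<inter> P') \<le> 1"
    if P: "P \<in> nsets (T - {i}) (r - 1)" "P' \<in> nsets (T - {i}) (r - 1)" for P P'
    using tr
  proof
    assume "t = 2 \<and> r = 2"
    then have "card P = 1" "finite P" using P by (auto simp: nsets_def)
    then have "card (P \<inter> P) \<le> 1" "card (P \<inter> P') \<le> 1" using card_mono[of P "P \<inter> P'"] by auto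
    then show ?thesis using P by blast
  next
    assume t: "t = 4 \<and> r = 3"
    have fS: "finite (T - {i})" "card (T - {i}) = 3" using T' True t by auto
    have nc: "card (nsets (T - {i}) 2) = 3" using fS by (simp add: card_nsets choose_two)
    have "\<not> nsets (T - {i}) 2 \<subseteq> {P, P'}"
    proof
      assume sub: "nsets (T - {i}) 2 \<subseteq> {P, P'}"
      have "card (nsets (T - {i}) 2) \<le> card {P, P'}" by (rule card_mono[OF _ sub]) simp
      also have "\<dots> \<le> 2" by (simp add: card_insert_if)
      finally show False unfolding nc by simp
    qed
    then obtain Q where Q: "Q \<in> nsets (T - {i}) 2" "Q \<noteq> P" "Q \<noteq> P'" by blast
    have "card (Q \<inter> R) \<le> 1" if "R \<in> nsets (T - {i}) 2" "Q \<noteq> R" for R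
    proof -
      have R: "finite Q" "card Q = 2" "finite R" "card R = 2" using that Q by (auto simp: nsets_def)
      then have "\<not> Q \<subseteq> R" using card_subset_eq[of R Q] that by auto
      then have "card (Q \<inter> R) < card Q" using R by (intro psubset_card_mono) auto
      then show ?thesis using R by simp
    qed
    then show ?thesis using Q P t by auto
  qed
  have n': "card T + 1 + 3 * (k - r) \<le> n" using n T' by simp
  have "T' \<in> nsets {1..n} t"
    using swap_in_mem_nsets[OF Tt, of i j] True ij by simp
  moreover have "\<F> = core_family n k T r \<and> \<G> = core_family n k T r \<or>
    \<F> = core_family n k T' r \<and> \<G> = core_family n k T' r"
    by (rule unshift_dichotomy[OF split_separated[OF n' rk sep] X sub F G])
  ultimately show ?thesis using Tt by (elim disjE) (rule bexI; assumption)+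
qed

section \<open>Numerical inequalities and upper shadows\<close>

text \<open>With \<open>N = n - k + 2 - j\<close> and \<open>m = i + j - 2\<close>, this and the
  next two inequalities contradict the combination of \<open>threshold\<close> and
  \<open>two_levels\<close>. For \<open>j \<ge> i + 2\<close> the core of the matter is
  \<open>i * N < (N - (k - j + 1)) * (i + j - 2)\<close>.\<close>

lemma exchange_bound_wide:
  fixes i j k N :: int
  assumes "2 \<le> i" "i + 2 \<le> j" "j \<le> k" "2 * k - 1 - j \<le> N"
  shows "i * (i + 1) * (N + 1) * N
    < (N - (k - j + 1)) * (i + j - 2) * ((i + 1) * (N + 1) + (j - 2) * (k - i))"
proof -
  \<comment> \<open>The gap at the extreme values \<open>N = 2 * k - 1 - j\<close> and
    \<open>i = j - 2\<close>.\<close>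
  have "0 < (j - 2) * (j - 3)" using assms by simp
  also have "(j - 2) * (j - 3) = (2 * k - 1 - j) * (j - 2) - (k - j + 1) * (2 * j - 4)"
    by (simp add: algebra_simps)
  also have "\<dots> \<le> N * (j - 2) - (k - j + 1) * (i + j - 2)"
    using assms by (intro diff_mono[OF mult_right_mono mult_left_mono]) auto
  finally have "i * N < (N - (k - j + 1)) * (i + j - 2)" by (simp add: algebra_simps)
  then have "i * N * ((i + 1) * (N + 1)) < (N - (k - j + 1)) * (i + j - 2) * ((i + 1) * (N + 1))"
    using assms by (intro mult_strict_right_mono mult_pos_pos) auto
  moreover have "0 \<le> (N - (k - j + 1)) * (i + j - 2) * ((j - 2) * (k - i))"
    using assms by (intro mult_nonneg_nonneg) auto
  ultimately show ?thesis by (simp add: algebra_simps)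
qed

text \<open>Shifting the variables to their least values turns the difference of the two sides into a
  polynomial with positive coefficients.\<close>

lemma exchange_bound_succ:
  fixes i j k N :: int
  assumes "3 \<le> i" "j = i + 1" "j \<le> k" "2 * k - 1 - j \<le> N"
  shows "i * (i + 1) * (N + 1) * N
    < (N - (k - j + 1)) * (i + j - 2) * ((i + 1) * (N + 1) + (j - 2) * (k - i))"
proof -
  define u v z where "u = i - 3" and "v = k - i - 1" and "z = N - (2 * k - 1 - j)"
  then have nonneg: "0 \<le> u" "0 \<le> v" "0 \<le> z"
    and eq: "i = 3 + u" "j = 4 + u" "k = 4 + u + v" "N = 3 + u + 2 * v + z"
    using assms by linarith+
  have "(N - (k - j + 1)) * (i + j - 2) * ((i + 1) * (N + 1) + (j - 2) * (k - i))
      - i * (i + 1) * (N + 1) * N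
    = 36 + 46*z + 8*z*z + 22*v + 22*v*z + 2*v*v + 84*u + 54*u*z + 6*u*z*z + 55*u*v + 20*u*v*z +
      7*u*v*v + 54*u*u + 19*u*u*z + 1*u*u*z*z + 28*u*u*v + 4*u*u*v*z + 2*u*u*v*v + 13*u*u*u +
      2*u*u*u*z + 4*u*u*u*v + 1*u*u*u*u"
    unfolding eq by (simp add: algebra_simps)
  also have "\<dots> > 0" using nonneg by (intro add_pos_nonneg mult_nonneg_nonneg) simp_all
  finally show ?thesis by simp
qed

text \<open>At \<open>i = j = k = 4\<close> and \<open>N = 3\<close> both sides equal 240; this tie
  is why the range starts at 5 and the size pair (4, 4) gets its own estimate.\<close>

lemma exchange_bound_equal:
  fixes i j k N :: int
  assumes "5 \<le> i" "j = i" "j \<le> k" "2 * k - 1 - j \<le> N"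
  shows "i * (i + 1) * (N + 1) * N
    < (N - (k - j + 1)) * (i + j - 2) * ((i + 1) * (N + 1) + (j - 2) * (k - i))"
proof -
  define u v z where "u = i - 5" and "v = k - i" and "z = N - (2 * k - 1 - j)"
  then have nonneg: "0 \<le> u" "0 \<le> v" "0 \<le> z"
    and eq: "i = 5 + u" "j = 5 + u" "k = 5 + u + v" "N = 4 + u + 2 * v + z"
    using assms by auto
  have "(N - (k - j + 1)) * (i + j - 2) * ((i + 1) * (N + 1) + (j - 2) * (k - i))
      - i * (i + 1) * (N + 1) * N
    = 120 + 114*z + 18*z*z + 60*v + 48*v*z + 194*u + 97*u*z + 9*u*z*z + 112*u*v + 30*u*v*z +
      10*u*v*v + 89*u*u + 25*u*u*z + 1*u*u*z*z + 40*u*u*v + 4*u*u*v*z + 2*u*u*v*v + 16*u*u*u +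
      2*u*u*u*z + 4*u*u*u*v + 1*u*u*u*u"
    unfolding eq by (simp add: algebra_simps)
  also have "\<dots> > 0" using nonneg by (intro add_pos_nonneg mult_nonneg_nonneg) simp_all
  finally show ?thesis by simp
qed

lemma exchange_bound_six:
  fixes k N x :: int
  assumes "4 \<le> k" "2 * k - 5 \<le> N" "0 \<le> x" "x \<le> 9"
  shows "10 * x * N * (k - 3) * (N + 1)
    < (N - (k - 3)) * (10 * N * (N + 1) + x * (15 * (k - 3) * (N + 1) + 6 * (k - 4) * (k - 3)))"
proof -
  define v z where "v = k - 4" and "z = N - (2 * k - 5)"
  then have nonneg: "0 \<le> v" "0 \<le> z" and eq: "k = 4 + v" "N = 3 + 2 * v + z"
    using assms by auto
  \<comment> \<open>The difference of the two sides is \<open>c + x * d\<close>, linear in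
    \<open>x\<close>; it is positive at 0 and at 9, hence in between.\<close>
  define c d where "c = (N - (k - 3)) * (10 * N * (N + 1))"
    and "d = (N - (k - 3)) * (15 * (k - 3) * (N + 1) + 6 * (k - 4) * (k - 3))
      - 10 * N * (k - 3) * (N + 1)"
  have "c + 9 * d = 240 + 440*z + 135*z*z + 10*z*z*z + 328*v + 569*v*z + 95*v*z*z + 112*v*v + 179*v*v*z +
      4*v*v*v"
    unfolding c_def d_def eq by (simp add: algebra_simps)
  also have "\<dots> > 0" using nonneg by (intro add_pos_nonneg mult_nonneg_nonneg) simp_all
  finally have cd: "0 < c + 9 * d" .
  have c: "0 < c" unfolding c_def using assms by simp
  have "0 < (9 - x) * c + x * (c + 9 * d)"
  proof (cases "x = 9")
    case False
    then show ?thesis using assms c cd by (intro add_pos_nonneg mult_pos_pos mult_nonneg_nonneg) auto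
  qed (use cd in simp)
  also have "\<dots> = 9 * (c + x * d)" by (simp add: algebra_simps)
  finally show ?thesis by (simp add: c_def d_def algebra_simps)
qed

text \<open>The local LYM inequality: pairs of a set \<open>A\<close> and a new point
  \<open>v\<close> inject into pairs of a member of \<open>\<D>\<close> and one of its
  points.\<close>

lemma card_upper_shadow:
  assumes V: "finite V" and C: "\<C> \<subseteq> nsets V r" and D: "finite \<D>" "\<And>B. B \<in> \<D> \<Longrightarrow> finite B \<and> card B = r + 1"
    and CD: "\<And>A v. A \<in> \<C> \<Longrightarrow> v \<in> V - A \<Longrightarrow> insert v A \<in> \<D>"
  shows "card \<C> * (card V - r) \<le> card \<D> * (r + 1)"
proof -
  let ?P = "SIGMA A:\<C>. V - A" and ?Q = "SIGMA B:\<D>. B"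
  have fC: "finite \<C>" using C V finite_imp_finite_nsets finite_subset by blast
  have cA: "card (V - A) = card V - r" if "A \<in> \<C>" for A
    using that C by (auto simp: nsets_def card_Diff_subset)
  have "card ?P = (\<Sum>A\<in>\<C>. card (V - A))" using fC V by (intro card_SigmaI) auto
  then have P: "card ?P = card \<C> * (card V - r)" using cA by simp
  have "card ?Q = (\<Sum>B\<in>\<D>. card B)" using D by (intro card_SigmaI) auto
  then have Q: "card ?Q = card \<D> * (r + 1)" using D by simp
  have "card ?P \<le> card ?Q"
  proof (rule card_inj_on_le)
    show "inj_on (\<lambda>(A, v). (insert v A, v)) ?P" by (auto simp: inj_on_def insert_ident)
    show "(\<lambda>(A, v). (insert v A, v)) ` ?P \<subseteq> ?Q" using CD by auto
    show "finite ?Q" using D by auto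
  qed
  then show ?thesis using P Q by simp
qed

section \<open>Weights of traces\<close>

lemma factors_eq_max:
  fixes a b c :: nat
  assumes "c * c \<le> a * b" "a \<le> c" "b \<le> c" "0 < c"
  shows "a = c \<and> b = c"
proof -
  have "c * c \<le> a * c" "c * c \<le> c * b"
    using assms(1) mult_le_mono2[OF assms(3), of a] mult_le_mono1[OF assms(2), of b] by linarith+
  then show ?thesis using assms by simp
qed

locale ekr_range =
  fixes n k :: nat
  assumes k2: "k \<ge> 2" and n3: "n \<ge> 3 * (k - 1)"
begin

definition lev :: "nat \<Rightarrow> nat set set" where
  "lev m = {A. A \<subseteq> {1..m} \<and> card A \<le> k}"

text \<open>The number of \<open>k\<close>-sets with a given trace of size \<open>s\<close> on \<open>{1..m}\<close>; without the case distinction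
  truncated subtraction would give \<open>1\<close> for \<open>s > k\<close>.\<close>

definition wt :: "nat \<Rightarrow> nat \<Rightarrow> nat" where
  "wt m s = (if s \<le> k then (n - m) choose (k - s) else 0)"

definition lift :: "nat \<Rightarrow> nat set set \<Rightarrow> nat set set" where
  "lift m \<A> = {F \<in> nsets {1..n} k. F \<inter> {1..m} \<in> \<A>}"

lemma finite_lev: "finite (lev m)"
  unfolding lev_def by (rule finite_subset[of _ "Pow {1..m}"]) auto

lemma finite_lift [simp]: "finite (lift m \<A>)"
  by (simp add: lift_def finite_imp_finite_nsets)

lemma lift_subset: "lift m \<A> \<subseteq> nsets {1..n} k"
  by (auto simp: lift_def)

lemma card_lift_single:
  assumes "m \<le> n" "A \<subseteq> {1..m}"
  shows "card (lift m {A}) = wt m (card A)"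
proof (cases "card A \<le> k")
  case True
  have finA: "finite A" using assms finite_subset by blast
  have "bij_betw (\<lambda>F. F - {1..m}) (lift m {A}) (nsets {m+1..n} (k - card A))"
  proof (rule bij_betw_byWitness[where f' = "\<lambda>R. A \<union> R"])
    show "\<forall>F\<in>lift m {A}. A \<union> (F - {1..m}) = F" by (auto simp: lift_def)
    show "\<forall>R\<in>nsets {m+1..n} (k - card A). A \<union> R - {1..m} = R"
      using assms by (auto simp: nsets_def)
    show "(\<lambda>F. F - {1..m}) ` lift m {A} \<subseteq> nsets {m+1..n} (k - card A)"
    proof
      fix R assume "R \<in> (\<lambda>F. F - {1..m}) ` lift m {A}"
      then obtain F where F: "R = F - {1..m}" "F \<subseteq> {1..n}" "finite F" "card F = k" "F \<inter> {1..m} = A"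
        by (auto simp: lift_def nsets_def)
      have "R = F - A" using F by auto
      then have "card R = k - card A" using F finA by (auto simp: card_Diff_subset)
      then show "R \<in> nsets {m+1..n} (k - card A)" using F by (auto simp: nsets_def)
    qed
    show "(\<union>) A ` nsets {m+1..n} (k - card A) \<subseteq> lift m {A}"
    proof
      fix F assume "F \<in> (\<union>) A ` nsets {m+1..n} (k - card A)"
      then obtain R where R: "F = A \<union> R" "R \<subseteq> {m+1..n}" "finite R" "card R = k - card A"
        by (auto simp: nsets_def)
      have disj: "{1..m} \<inter> {m+1..n} = {}" "{m+1..n} \<subseteq> {1..n}" "{1..m} \<subseteq> {1..n}"
        using assms(1) by auto
      then have "A \<inter> R = {}" using R assms(2) by blast
      then have "card F = k" using R finA True by (simp add: card_Un_disjoint)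
      moreover have "F \<inter> {1..m} = A" "F \<subseteq> {1..n}" using R(1,2) assms(2) disj by blast+
      ultimately show "F \<in> lift m {A}" using R finA by (auto simp: lift_def nsets_def)
    qed
  qed
  then have "card (lift m {A}) = card (nsets {m+1..n} (k - card A))" by (rule bij_betw_same_card)
  then show ?thesis using True by (simp add: wt_def)
next
  case False
  have "lift m {A} = {}"
  proof (rule ccontr)
    assume "lift m {A} \<noteq> {}"
    then obtain F where "finite F" "card F = k" "A \<subseteq> F" by (auto simp: lift_def nsets_def)
    then have "card A \<le> k" using card_mono by blast
    with False show False by simp
  qed
  then show ?thesis using False by (simp add: wt_def)
qed

lemma card_lift:
  assumes "m \<le> n" "\<A> \<subseteq> lev m"
  shows "card (lift m \<A>) = (\<Sum>A\<in>\<A>. wt m (card A))"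
proof -
  have "lift m \<A> = (\<Union>A\<in>\<A>. lift m {A})" by (auto simp: lift_def)
  moreover have "card (\<Union>A\<in>\<A>. lift m {A}) = (\<Sum>A\<in>\<A>. card (lift m {A}))"
    using finite_subset[OF assms(2) finite_lev] by (intro card_UN_disjoint) (auto simp: lift_def finite_imp_finite_nsets)
  moreover have "card (lift m {A}) = wt m (card A)" if "A \<in> \<A>" for A
    using card_lift_single assms that by (auto simp: lev_def)
  ultimately show ?thesis by simp
qed

lemma card_lift_Un:
  assumes "m \<le> n" "\<A> \<subseteq> lev m" "\<B> \<subseteq> lev m" "\<A> \<inter> \<B> = {}" and "\<And>B. B \<in> \<B> \<Longrightarrow> card B = s"
  shows "card (lift m (\<A> \<union> \<B>)) = card (lift m \<A>) + card \<B> * wt m s"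
proof -
  have "finite \<A>" "finite \<B>" using assms finite_lev finite_subset by blast+
  then have "card (lift m (\<A> \<union> \<B>)) = card (lift m \<A>) + (\<Sum>A\<in>\<B>. wt m (card A))"
    using assms by (simp add: card_lift sum.union_disjoint)
  then show ?thesis using assms(5) by simp
qed

lemma card_lift_levels:
  assumes "m \<le> n" "\<A> \<subseteq> lev m"
  shows "card (lift m \<A>) = (\<Sum>s\<le>m. card {A \<in> \<A>. card A = s} * wt m s)"
proof -
  have fin: "finite \<A>" using assms finite_lev finite_subset by blast
  have le: "card A \<le> m" if "A \<in> \<A>" for A
    using that assms(2) card_mono[of "{1..m}" A] by (auto simp: lev_def)
  have "(\<Sum>A\<in>\<A>. wt m (card A)) = (\<Sum>s\<le>m. \<Sum>A\<in>{A \<in> \<A>. card A = s}. wt m (card A))"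
    using sum.group[of \<A> "{..m}" card "\<lambda>A. wt m (card A)"] fin le by (simp add: image_subset_iff)
  also have "\<dots> = (\<Sum>s\<le>m. card {A \<in> \<A>. card A = s} * wt m s)"
  proof (rule sum.cong[OF refl])
    fix s
    have "(\<Sum>A\<in>{A \<in> \<A>. card A = s}. wt m (card A)) = (\<Sum>A\<in>{A \<in> \<A>. card A = s}. wt m s)"
      by (rule sum.cong) auto
    then show "(\<Sum>A\<in>{A \<in> \<A>. card A = s}. wt m (card A)) = card {A \<in> \<A>. card A = s} * wt m s"
      by simp
  qed
  finally show ?thesis unfolding card_lift[OF assms] .
qed

lemma card_level_le:
  assumes "\<A> \<subseteq> lev m"
  shows "card {A \<in> \<A>. card A = s} \<le> m choose s"
proof -
  have "{A \<in> \<A>. card A = s} \<subseteq> nsets {1..m} s"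
    using assms finite_subset[of _ "{1..m}"] by (auto simp: lev_def nsets_def subset_eq)
  then have "card {A \<in> \<A>. card A = s} \<le> card (nsets {1..m} s)"
    by (intro card_mono) (auto simp: finite_imp_finite_nsets)
  then show ?thesis by simp
qed

text \<open>Absorption for binomial coefficients; it fixes the exchange rate between a trace and the
  same trace with one point deleted.\<close>

lemma wt_step:
  assumes "1 \<le> s" "s \<le> k" "m \<le> n"
  shows "(k + 1 - s) * wt m (s - 1) = (n + s - m - k) * wt m s"
proof -
  have "(n - m - (k - s)) * ((n - m) choose (k - s)) = Suc (k - s) * ((n - m) choose Suc (k - s))"
    by (metis binomial_absorb_comp binomial_absorption)
  moreover have "k - (s - 1) = Suc (k - s)" "k + 1 - s = Suc (k - s)" "n + s - m - k = n - m - (k - s)"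
    using assms by auto
  moreover have "s - 1 \<le> k" using assms by simp
  ultimately show ?thesis using assms(2) unfolding wt_def by presburger
qed

text \<open>Sets with a given trace are split according to whether they contain
  \<open>m + 1\<close>.\<close>

lemma wt_Pascal:
  assumes "m < n"
  shows "wt m s = wt (m + 1) s + wt (m + 1) (s + 1)"
proof (cases "s < k")
  case True
  then obtain r where r: "k - s = Suc r" "k - (s + 1) = r" by (metis Suc_diff_Suc Suc_eq_plus1)
  have "n - m = Suc (n - (m + 1))" using assms by simp
  then show ?thesis using True r by (simp add: wt_def)
qed (auto simp: wt_def)

lemma wt_pos: "1 \<le> s \<Longrightarrow> s \<le> k \<Longrightarrow> m + k \<le> n + 1 \<Longrightarrow> 0 < wt m s"
  by (simp add: wt_def)

section \<open>The size of a star in terms of trace weights\<close>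

abbreviation S :: nat where
  "S \<equiv> (n - 2) choose (k - 2)"

lemma n_ge: "n \<ge> k + 1" "n \<ge> 3"
  using k2 n3 by auto

lemma S_wt2: "S = wt 2 2"
  using k2 by (simp add: wt_def)

lemma S_pos: "0 < S"
  using n_ge by simp

text \<open>Iterating Pascal's rule from \<open>wt 2 2\<close>; the coefficients here and below
  count the traces containing {1, 2} by size.\<close>

lemma S_wt3: "S = wt 3 2 + wt 3 3"
  unfolding S_wt2 using wt_Pascal[of 2 2] n_ge by simp

lemma S_wt4: "n \<ge> 4 \<Longrightarrow> S = wt 4 2 + 2 * wt 4 3 + wt 4 4"
  unfolding S_wt3 using wt_Pascal[of 3 2] wt_Pascal[of 3 3] by simp

lemma S_wt6: "n \<ge> 6 \<Longrightarrow> S = wt 6 2 + 4 * wt 6 3 + 6 * wt 6 4 + 4 * wt 6 5 + wt 6 6"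
  using S_wt4 unfolding S_wt3 using wt_Pascal[of 4 2] wt_Pascal[of 4 3] wt_Pascal[of 4 4]
    wt_Pascal[of 5 2] wt_Pascal[of 5 3] wt_Pascal[of 5 4] wt_Pascal[of 5 5]
  by simp

lemma cross_intersecting_lift:
  assumes "cross_intersecting t \<A> \<B>"
  shows "cross_intersecting t (lift m \<A>) (lift m \<B>)"
  unfolding cross_intersecting_def
proof (intro ballI)
  fix F G assume FG: "F \<in> lift m \<A>" "G \<in> lift m \<B>"
  then have "t \<le> card ((F \<inter> {1..m}) \<inter> (G \<inter> {1..m}))"
    using assms by (auto simp: lift_def cross_intersecting_def)
  also have "\<dots> \<le> card (F \<inter> G)" using FG by (intro card_mono) (auto simp: lift_def nsets_def)
  finally show "t \<le> card (F \<inter> G)" .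
qed

lemma card_star: "card (core_family n k {1, 2} 2) = S"
proof -
  have "core_family n k {1, 2} 2 = lift 2 {{1, 2}}"
  proof -
    have "2 \<le> card (F \<inter> {1, 2}) \<longleftrightarrow> F \<inter> {1..2} = {1, 2}" for F :: "nat set"
    proof -
      have "{1..2} = {1, 2::nat}" by auto
      moreover have "F \<inter> {1, 2} = {1, 2}" if "2 \<le> card (F \<inter> {1, 2})"
        using that by (intro card_seteq) auto
      ultimately show ?thesis by auto
    qed
    then show ?thesis by (auto simp: core_family_def lift_def)
  qed
  then show ?thesis using card_lift_single[of 2 "{1, 2}"] n_ge S_wt2 by (auto simp: numeral_2_eq_2)
qed

end

section \<open>Traces of an optimal shifted pair\<close>

context ekr_range
begin

text \<open>Closing upwards only enlarges intersections. For the optimal pairs below, every set in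
  the closure turns out to be an actual trace.\<close>

definition traces :: "nat \<Rightarrow> nat set set \<Rightarrow> nat set set" where
  "traces m \<H> = {A \<in> lev m. \<exists>H\<in>\<H>. H \<inter> {1..m} \<subseteq> A}"

text \<open>The critical traces of size \<open>i\<close>: deleting \<open>m\<close> produces a set
  that is not yet a trace, so it would enlarge the family.\<close>

definition pivots :: "nat \<Rightarrow> nat set set \<Rightarrow> nat \<Rightarrow> nat set set" where
  "pivots m \<H> i = {A \<in> traces m \<H>. card A = i \<and> m \<in> A \<and> A - {m} \<notin> traces m \<H>}"

lemma inj_on_pivots: "inj_on (\<lambda>A. A - {m}) (pivots m \<H> i)"
proof (rule inj_onI)
  fix A B assume AB: "A \<in> pivots m \<H> i" "B \<in> pivots m \<H> i" and eq: "A - {m} = B - {m}"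
  have "A = insert m (A - {m})" "B = insert m (B - {m})" using AB by (auto simp: pivots_def)
  then show "A = B" unfolding eq by simp
qed

lemma traces_subset: "traces m \<H> \<subseteq> lev m"
  by (auto simp: traces_def)

lemma traces_upward: "A \<in> traces m \<H> \<Longrightarrow> A \<subseteq> B \<Longrightarrow> B \<in> lev m \<Longrightarrow> B \<in> traces m \<H>"
  by (auto simp: traces_def)

lemma subset_lift_traces:
  assumes "\<H> \<subseteq> nsets {1..n} k"
  shows "\<H> \<subseteq> lift m (traces m \<H>)"
proof
  fix H assume H: "H \<in> \<H>"
  then have "H \<in> nsets {1..n} k" using assms by blast
  moreover from this have "card (H \<inter> {1..m}) \<le> k"
    using card_mono[of H "H \<inter> {1..m}"] by (auto simp: nsets_def)
  ultimately show "H \<in> lift m (traces m \<H>)" using H by (auto simp: lift_def traces_def lev_def)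
qed

definition optimal :: "nat set set \<Rightarrow> nat set set \<Rightarrow> bool" where
  "optimal \<F> \<G> \<longleftrightarrow> \<F> \<subseteq> nsets {1..n} k \<and> \<G> \<subseteq> nsets {1..n} k \<and> cross_intersecting 2 \<F> \<G> \<and>
    (\<forall>\<F>' \<G>'. \<F>' \<subseteq> nsets {1..n} k \<longrightarrow> \<G>' \<subseteq> nsets {1..n} k \<longrightarrow> cross_intersecting 2 \<F>' \<G>' \<longrightarrow>
      card \<F>' * card \<G>' \<le> card \<F> * card \<G>)"

lemma optimal_commute: "optimal \<F> \<G> \<Longrightarrow> optimal \<G> \<F>"
  unfolding optimal_def by (simp add: cross_intersecting_commute[of 2 \<G>] mult.commute[of "card \<G>"])

lemma cross_star: "cross_intersecting 2 (core_family n k {1, 2} 2) (core_family n k {1, 2} 2)"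
  unfolding cross_intersecting_def
proof (intro ballI)
  fix A B assume AB: "A \<in> core_family n k {1, 2} 2" "B \<in> core_family n k {1, 2} 2"
  have sub: "{1, 2} \<subseteq> H" if "H \<in> core_family n k {1, 2} 2" for H
  proof -
    have "H \<inter> {1, 2} = {1, 2}" using that by (intro card_seteq) (auto simp: core_family_def)
    then show ?thesis by blast
  qed
  have "card {1, 2::nat} \<le> card (A \<inter> B)"
    using sub[OF AB(1)] sub[OF AB(2)] AB by (intro card_mono) (auto simp: core_family_def nsets_def)
  then show "2 \<le> card (A \<inter> B)" by simp
qed

lemma optimal_ge:
  assumes "optimal \<F> \<G>"
  shows "S\<^sup>2 \<le> card \<F> * card \<G>"
proof -
  have "core_family n k {1, 2} 2 \<subseteq> nsets {1..n} k" by (auto simp: core_family_def)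
  then show ?thesis using assms cross_star card_star unfolding optimal_def power2_eq_square by metis
qed

lemma optimal_pos:
  assumes "optimal \<F> \<G>"
  shows "0 < card \<F>" "0 < card \<G>"
  using optimal_ge[OF assms] S_pos by (metis gr0I mult_0 mult_0_right not_le zero_less_power)+

end

text \<open>\<open>meet\<close> and \<open>tight\<close> say that \<open>m\<close> is least such
  that the traces on \<open>{1..m}\<close> are cross 2-intersecting; \<open>m \<ge> 3\<close> sets
  the star case aside.\<close>

locale shifted_optimum = ekr_range n k for n k :: nat +
  fixes \<F> \<G> :: "nat set set" and m :: nat
  assumes optimal: "optimal \<F> \<G>" and shF: "shifted \<F>" and shG: "shifted \<G>"
    and m: "3 \<le> m" "m \<le> 2 * k - 2"
    and meet: "\<And>A B. A \<in> \<F> \<Longrightarrow> B \<in> \<G> \<Longrightarrow> 2 \<le> card (A \<inter> B \<inter> {1..m})"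
    and tight: "\<exists>A\<in>\<F>. \<exists>B\<in>\<G>. card (A \<inter> B \<inter> {1..m - 1}) < 2"
begin

lemma F: "\<F> \<subseteq> nsets {1..n} k" and G: "\<G> \<subseteq> nsets {1..n} k"
  and opt: "\<F>' \<subseteq> nsets {1..n} k \<Longrightarrow> \<G>' \<subseteq> nsets {1..n} k \<Longrightarrow>
    cross_intersecting 2 \<F>' \<G>' \<Longrightarrow> card \<F>' * card \<G>' \<le> card \<F> * card \<G>"
  using optimal unfolding optimal_def by blast+

text \<open>Lets every one-sided statement be applied to \<open>\<G>\<close> as well.\<close>

lemma sym: "shifted_optimum n k \<G> \<F> m"
proof
  show "optimal \<G> \<F>" by (rule optimal_commute[OF optimal])
  show "2 \<le> card (A \<inter> B \<inter> {1..m})" if "A \<in> \<G>" "B \<in> \<F>" for A B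
    using meet[OF that(2,1)] by (simp add: Int_commute)
  show "\<exists>A\<in>\<G>. \<exists>B\<in>\<F>. card (A \<inter> B \<inter> {1..m - 1}) < 2"
    using tight by (metis Int_commute)
qed (use shF shG m in auto)

text \<open>Since \<open>m \<le> 2 * k - 2\<close>, the bound \<open>n \<ge> 3 * (k - 1)\<close>
  leaves at least \<open>k - 1\<close> points beyond \<open>m\<close>.\<close>

lemma m_le: "m + k \<le> n + 1" "m \<le> n" "3 \<le> k"
  using m n3 k2 by auto

lemmas S_le = optimal_ge[OF optimal] and card_pos = optimal_pos[OF optimal]

lemma cross_traces: "cross_intersecting 2 (traces m \<F>) (traces m \<G>)"
  unfolding cross_intersecting_def
proof (intro ballI)
  fix A B assume "A \<in> traces m \<F>" "B \<in> traces m \<G>"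
  then obtain A0 B0 where "A0 \<in> \<F>" "B0 \<in> \<G>" and sub: "A0 \<inter> {1..m} \<subseteq> A" "B0 \<inter> {1..m} \<subseteq> B"
    and "A \<subseteq> {1..m}" by (auto simp: traces_def lev_def)
  then have "2 \<le> card (A0 \<inter> B0 \<inter> {1..m})" "finite A" using meet finite_subset[of A "{1..m}"] by auto
  moreover have "card (A0 \<inter> B0 \<inter> {1..m}) \<le> card (A \<inter> B)"
    using sub \<open>finite A\<close> by (intro card_mono) auto
  ultimately show "2 \<le> card (A \<inter> B)" by linarith
qed

lemma opt_lift:
  assumes "cross_intersecting 2 \<A> \<B>"
  shows "card (lift m \<A>) * card (lift m \<B>) \<le> card \<F> * card \<G>"
  using opt[OF lift_subset lift_subset cross_intersecting_lift[OF assms]] .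

text \<open>The liftings contain the two families and are still cross 2-intersecting, so optimality
  leaves no room for a proper enlargement.\<close>

lemma lift_traces: "lift m (traces m \<F>) = \<F>"
proof -
  have "card \<G> \<le> card (lift m (traces m \<G>))"
    using subset_lift_traces[OF G] by (intro card_mono) auto
  then have "card (lift m (traces m \<F>)) * card \<G> \<le> card (lift m (traces m \<F>)) * card (lift m (traces m \<G>))"
    by (rule mult_le_mono2)
  also have "\<dots> \<le> card \<F> * card \<G>" by (rule opt_lift[OF cross_traces])
  finally have "card (lift m (traces m \<F>)) \<le> card \<F>" using card_pos by simp
  then show ?thesis using card_seteq[OF finite_lift subset_lift_traces[OF F]] by auto
qed

lemma card_levels: "card \<F> = (\<Sum>s\<le>m. card {A \<in> traces m \<F>. card A = s} * wt m s)"
  using card_lift_levels[OF m_le(2) traces_subset[of m \<F>]] unfolding lift_traces .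

lemma mem_traces: "A \<in> traces m \<F> \<Longrightarrow> A \<subseteq> {1..m} \<and> finite A \<and> 2 \<le> card A \<and> card A \<le> k"
proof -
  assume A: "A \<in> traces m \<F>"
  then have A': "A \<subseteq> {1..m}" "card A \<le> k" using traces_subset by (auto simp: lev_def)
  then have fin: "finite A" using finite_subset by blast
  have "\<G> \<noteq> {}" using card_pos by auto
  then obtain B where "B \<in> \<G>" by blast
  then have "B \<inter> {1..m} \<in> traces m \<G>" using subset_lift_traces[OF G] by (auto simp: lift_def)
  then have "2 \<le> card (A \<inter> (B \<inter> {1..m}))" using A cross_traces unfolding cross_intersecting_def by blast
  also have "\<dots> \<le> card A" using fin by (intro card_mono) auto
  finally show ?thesis using A' fin by simp
qed

text \<open>A trace has at least two points, so at most \<open>k - 2\<close> points beyond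
  \<open>m\<close> complete it to a \<open>k\<close>-set, which is a member by
  \<open>lift_traces\<close>.\<close>

lemma traces_exact:
  assumes "A \<in> traces m \<F>"
  shows "\<exists>H\<in>\<F>. H \<inter> {1..m} = A"
proof -
  have A: "A \<subseteq> {1..m}" "finite A" "2 \<le> card A" "card A \<le> k" using mem_traces[OF assms] by auto
  have "k - card A \<le> card {m+1..n}" using A m_le by simp
  then obtain R where R: "R \<subseteq> {m+1..n}" "card R = k - card A" "finite R"
    by (rule obtain_subset_with_card_n)
  have disj: "{1..m} \<inter> {m+1..n} = {}" "{m+1..n} \<subseteq> {1..n}" "{1..m} \<subseteq> {1..n}"
    using m_le by auto
  then have "A \<inter> R = {}" using R A by blast
  then have "card (A \<union> R) = k" using R A by (simp add: card_Un_disjoint)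
  moreover have eq: "(A \<union> R) \<inter> {1..m} = A" "A \<union> R \<subseteq> {1..n}" using R(1) A(1) disj by blast+
  ultimately have "A \<union> R \<in> lift m (traces m \<F>)" using assms R A by (simp add: lift_def nsets_def)
  then show ?thesis using eq lift_traces by blast
qed

lemma traces_swap:
  assumes A: "A \<in> traces m \<F>" "1 \<le> l" "l < c" "c \<in> A" "l \<notin> A"
  shows "swap_in l c A \<in> traces m \<F>"
proof -
  obtain H where H: "H \<in> \<F>" "H \<inter> {1..m} = A" using traces_exact[OF A(1)] by blast
  have "A \<subseteq> {1..m}" using mem_traces[OF A(1)] by simp
  then have c: "c \<le> m" using A by auto
  then have lH: "l \<notin> H" "c \<in> H" using H A by auto
  then have "swap_in l c H \<in> \<F>" using shF H A by (auto simp: shifted_def)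
  then have "swap_in l c H \<inter> {1..m} \<in> traces m \<F>" using subset_lift_traces[OF F] by (auto simp: lift_def)
  moreover have "swap_in l c H \<inter> {1..m} = swap_in l c A" using H A c by (auto simp: swap_in_def)
  ultimately show ?thesis by simp
qed

text \<open>A pair witnessing that \<open>m - 1\<close> is too small must share \<open>m\<close> and
  have exactly one further common point in \<open>{1..m}\<close>.\<close>

lemma tight_pair:
  obtains A B where "A \<in> traces m \<F>" "B \<in> traces m \<G>" "m \<in> A" "m \<in> B" "card (A \<inter> B) = 2"
proof -
  obtain A B where AB: "A \<in> \<F>" "B \<in> \<G>" "card (A \<inter> B \<inter> {1..m - 1}) < 2" using tight by blast
  have m2: "2 \<le> card (A \<inter> B \<inter> {1..m})" by (rule meet[OF AB(1,2)])
  have split: "{1..m} = insert m {1..m - 1}" using m by auto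
  have mAB: "m \<in> A \<inter> B"
  proof (rule ccontr)
    assume "m \<notin> A \<inter> B"
    then have "A \<inter> B \<inter> {1..m} = A \<inter> B \<inter> {1..m - 1}" unfolding split by blast
    then show False using AB m2 by simp
  qed
  then have "A \<inter> B \<inter> {1..m} = insert m (A \<inter> B \<inter> {1..m - 1})" unfolding split by blast
  moreover have "m \<notin> A \<inter> B \<inter> {1..m - 1}" using m by auto
  ultimately have "card (A \<inter> B \<inter> {1..m}) = Suc (card (A \<inter> B \<inter> {1..m - 1}))" by simp
  then have "card (A \<inter> B \<inter> {1..m}) = 2" using AB(3) m2 by linarith
  moreover have "(A \<inter> {1..m}) \<inter> (B \<inter> {1..m}) = A \<inter> B \<inter> {1..m}" by blast
  ultimately have "card ((A \<inter> {1..m}) \<inter> (B \<inter> {1..m})) = 2" by simp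
  moreover have "A \<inter> {1..m} \<in> traces m \<F>" "B \<inter> {1..m} \<in> traces m \<G>"
    using subset_lift_traces[OF F] subset_lift_traces[OF G] AB by (auto simp: lift_def)
  ultimately show thesis using that[of "A \<inter> {1..m}" "B \<inter> {1..m}"] mAB m by simp
qed

text \<open>If the union missed a point, shifting \<open>m\<close> there in \<open>A\<close> would leave a single common point.\<close>

lemma tight_pair_Un:
  assumes A: "A \<in> traces m \<F>" and B: "B \<in> traces m \<G>" and mAB: "m \<in> A" "m \<in> B" and two: "card (A \<inter> B) = 2"
  shows "A \<union> B = {1..m}" and "card A + card B = m + 2" and "A - {m} \<notin> traces m \<F>"
proof -
  have sub: "A \<subseteq> {1..m}" "finite A" using mem_traces[OF A] by auto
  have subB: "B \<subseteq> {1..m}" "finite B"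
    using B traces_subset[of m \<G>] finite_subset[of B "{1..m}"] by (auto simp: lev_def)
  have one: "card ((A - {m}) \<inter> B) = 1"
  proof -
    have "(A - {m}) \<inter> B = A \<inter> B - {m}" by blast
    then show ?thesis using two mAB by simp
  qed
  have crs': "2 \<le> card (E \<inter> B)" if "E \<in> traces m \<F>" for E
    using cross_traces that B unfolding cross_intersecting_def by blast
  show "A - {m} \<notin> traces m \<F>" using crs'[of "A - {m}"] one by auto
  show un: "A \<union> B = {1..m}"
  proof (rule ccontr)
    assume "A \<union> B \<noteq> {1..m}"
    then obtain l where l: "l \<in> {1..m}" "l \<notin> A" "l \<notin> B" using sub subB by blast
    then have "l < m" using mAB by (metis atLeastAtMost_iff le_neq_implies_less)
    then have "swap_in l m A \<in> traces m \<F>" using traces_swap[OF A, of l m] l mAB by simp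
    then have "2 \<le> card (swap_in l m A \<inter> B)" by (rule crs')
    moreover have "swap_in l m A \<inter> B = (A - {m}) \<inter> B" using l by (auto simp: swap_in_def)
    ultimately show False using one by simp
  qed
  show "card A + card B = m + 2" using card_Un_Int[OF sub(2) subB(2)] un two by simp
qed

text \<open>Critical traces make up at most the fraction \<open>i / m\<close> of level
  \<open>i\<close>. Deleting \<open>m\<close> and adding a smaller point is a downward swap, so the
  upper shadow in \<open>{1..m - 1}\<close> of the shortened sets consists of traces of size
  \<open>i\<close> avoiding \<open>m\<close>.\<close>

lemma card_pivots_level:
  assumes "i \<le> m"
  shows "card (pivots m \<F> i) * m \<le> card {A \<in> traces m \<F>. card A = i} * i"
proof (cases "pivots m \<F> i = {}")
  case False
  then obtain A0 where A0: "A0 \<in> pivots m \<F> i" by blast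
  then have i2: "2 \<le> i" using mem_traces[of A0] by (auto simp: pivots_def)
  let ?X = "pivots m \<F> i" and ?L = "{A \<in> traces m \<F>. card A = i}"
  let ?D = "{A \<in> traces m \<F>. card A = i \<and> m \<notin> A}" and ?C = "(\<lambda>A. A - {m}) ` pivots m \<F> i"
  have fin: "finite ?L" "finite ?D" "finite ?X"
    using finite_subset[OF traces_subset finite_lev] by (auto simp: pivots_def)
  note inj = inj_on_pivots[of m \<F> i]
  have "card ?C * (card {1..m - 1} - (i - 1)) \<le> card ?D * (i - 1 + 1)"
  proof (rule card_upper_shadow)
    show "?C \<subseteq> nsets {1..m - 1} (i - 1)"
    proof
      fix E assume "E \<in> ?C"
      then obtain A where A: "A \<in> traces m \<F>" "card A = i" "m \<in> A" "E = A - {m}" by (auto simp: pivots_def)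
      then have "A \<subseteq> {1..m}" "finite A" using mem_traces by auto
      then show "E \<in> nsets {1..m - 1} (i - 1)" using A by (force simp: nsets_def)
    qed
    show "finite B \<and> card B = i - 1 + 1" if "B \<in> ?D" for B using that mem_traces[of B] i2 by auto
    show "insert v E \<in> ?D" if E: "E \<in> ?C" and v: "v \<in> {1..m - 1} - E" for E v
    proof -
      obtain A where A: "A \<in> traces m \<F>" "card A = i" "m \<in> A" "E = A - {m}" using E by (auto simp: pivots_def)
      then have v': "v \<notin> A" "1 \<le> v" "v < m" using v by auto
      have "insert v E = swap_in v m A" using A by (simp add: swap_in_def)
      moreover have "card (swap_in v m A) = i" using card_swap_in[of A m v] A v' mem_traces[OF A(1)] by simp
      moreover have "m \<notin> swap_in v m A" using v' by (auto simp: swap_in_def)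
      ultimately show ?thesis using traces_swap[OF A(1), of v m] v' A by simp
    qed
  qed (use fin in auto)
  moreover have "card ?C = card ?X" by (rule card_image[OF inj])
  ultimately have 1: "card ?X * (m - i) \<le> card ?D * i" using i2 by simp
  have "?X \<union> ?D \<subseteq> ?L" "?X \<inter> ?D = {}" by (auto simp: pivots_def)
  then have "card ?X + card ?D \<le> card ?L"
    using fin card_mono[of ?L "?X \<union> ?D"] card_Un_disjoint[of ?X ?D] by simp
  then have "(card ?X + card ?D) * i \<le> card ?L * i" by (rule mult_le_mono1)
  moreover have "card ?X * m = card ?X * i + card ?X * (m - i)"
    using assms by (metis add_mult_distrib2 le_add_diff_inverse)
  ultimately show ?thesis using 1 by (simp add: add_mult_distrib)
qed simp

text \<open>Traces are closed upwards as long as sizes stay within \<open>k\<close>, so level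
  \<open>i + 1\<close> contains the upper shadow of level \<open>i\<close>.\<close>

lemma card_next_level:
  assumes "i + 1 \<le> k"
  shows "card {A \<in> traces m \<F>. card A = i} * (m - i) \<le> card {A \<in> traces m \<F>. card A = i + 1} * (i + 1)"
proof -
  have "card {A \<in> traces m \<F>. card A = i} * (card {1..m} - i) \<le> card {A \<in> traces m \<F>. card A = i + 1} * (i + 1)"
  proof (rule card_upper_shadow)
    show "{A \<in> traces m \<F>. card A = i} \<subseteq> nsets {1..m} i" using mem_traces by (auto simp: nsets_def)
    show "finite {A \<in> traces m \<F>. card A = i + 1}"
      using finite_subset[OF traces_subset finite_lev] by auto
    show "finite B \<and> card B = i + 1" if "B \<in> {A \<in> traces m \<F>. card A = i + 1}" for B
      using that mem_traces[of B] by auto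
    show "insert v A \<in> {A \<in> traces m \<F>. card A = i + 1}"
      if "A \<in> {A \<in> traces m \<F>. card A = i}" "v \<in> {1..m} - A" for A v
    proof -
      have A: "A \<in> traces m \<F>" "card A = i" "A \<subseteq> {1..m}" "finite A" using that mem_traces[of A] by auto
      then have "insert v A \<in> lev m" "card (insert v A) = i + 1"
        using that assms by (auto simp: lev_def)
      then show ?thesis using traces_upward[OF A(1), of "insert v A"] by auto
    qed
  qed simp
  then show ?thesis by simp
qed

text \<open>Deleting \<open>m\<close> from the members of \<open>pivots m \<F> i\<close> only conflicts with the members of \<open>pivots m \<G> j\<close>
  for the complementary size \<open>j\<close>.\<close>

lemma push:
  assumes ij: "i + j = m + 2" "1 \<le> i"
  shows "(card \<F> + card (pivots m \<F> i) * wt m (i - 1)) * (card \<G> - card (pivots m \<G> j) * wt m j)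
    \<le> card \<F> * card \<G>"
proof -
  interpret sym: shifted_optimum n k \<G> \<F> m by (rule sym)
  let ?X = "pivots m \<F> i" and ?Y = "pivots m \<G> j" and ?C = "(\<lambda>A. A - {m}) ` pivots m \<F> i"
  note inj = inj_on_pivots[of m \<F> i]
  have "cross_intersecting 2 (traces m \<F> \<union> ?C) (traces m \<G> - ?Y)"
    unfolding cross_intersecting_def
  proof (intro ballI)
    fix A B assume A: "A \<in> traces m \<F> \<union> ?C" and B: "B \<in> traces m \<G> - ?Y"
    show "2 \<le> card (A \<inter> B)"
    proof (cases "A \<in> traces m \<F>")
      case True
      then show ?thesis using B cross_traces unfolding cross_intersecting_def by blast
    next
      case False
      then obtain E where E: "E \<in> traces m \<F>" "card E = i" "m \<in> E" "A = E - {m}"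
        using A by (auto simp: pivots_def)
      have EB: "2 \<le> card (E \<inter> B)" using E B cross_traces unfolding cross_intersecting_def by blast
      have fin: "finite E" using mem_traces[OF E(1)] by simp
      show ?thesis
      proof (cases "m \<in> B")
        case False
        then have "A \<inter> B = E \<inter> B" using E by blast
        then show ?thesis using EB by simp
      next
        case True
        \<comment> \<open>If \<open>E\<close> and \<open>B\<close> met in two points only,
          \<open>B\<close> would be a critical trace of size \<open>j\<close>, and those have been
          removed.\<close>
        have "card (E \<inter> B) \<noteq> 2"
        proof
          assume two: "card (E \<inter> B) = 2"
          then have "card B = j" using tight_pair_Un(2)[OF E(1) _ E(3) True] B E ij by simp
          moreover have "B - {m} \<notin> traces m \<G>"
            using sym.tight_pair_Un(3)[of B E] B E True two by (simp add: Int_commute)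
          ultimately show False using B True by (auto simp: pivots_def)
        qed
        moreover have "A \<inter> B = E \<inter> B - {m}" using E by blast
        then have "card (A \<inter> B) = card (E \<inter> B) - 1" using E True by simp
        ultimately show ?thesis using EB by linarith
      qed
    qed
  qed
  then have le: "card (lift m (traces m \<F> \<union> ?C)) * card (lift m (traces m \<G> - ?Y)) \<le> card \<F> * card \<G>"
    by (rule opt_lift)
  have "?C \<subseteq> lev m"
  proof
    fix E assume "E \<in> ?C"
    then obtain A where "A \<in> lev m" "E = A - {m}" using traces_subset by (auto simp: pivots_def)
    then show "E \<in> lev m"
      using card_Diff1_le[of A m] by (auto simp: lev_def)
  qed
  moreover have "card E = i - 1" if "E \<in> ?C" for E using that mem_traces by (auto simp: pivots_def)
  moreover have "traces m \<F> \<inter> ?C = {}" by (auto simp: pivots_def)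
  ultimately have "card (lift m (traces m \<F> \<union> ?C)) = card (lift m (traces m \<F>)) + card ?C * wt m (i - 1)"
    by (intro card_lift_Un m_le traces_subset)
  then have 1: "card (lift m (traces m \<F> \<union> ?C)) = card \<F> + card ?X * wt m (i - 1)"
    using card_image[OF inj] lift_traces by simp
  have "?Y \<subseteq> traces m \<G>" by (auto simp: pivots_def)
  then have "(traces m \<G> - ?Y) \<union> ?Y = traces m \<G>" by blast
  moreover have "card (lift m ((traces m \<G> - ?Y) \<union> ?Y)) = card (lift m (traces m \<G> - ?Y)) + card ?Y * wt m j"
    using traces_subset[of m \<G>] \<open>?Y \<subseteq> traces m \<G>\<close> by (intro card_lift_Un m_le) (auto simp: pivots_def)
  ultimately have "card (lift m (traces m \<G> - ?Y)) = card \<G> - card ?Y * wt m j"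
    using sym.lift_traces by simp
  then show ?thesis using le 1 by simp
qed

text \<open>Guarantees that the subtraction in \<open>push\<close> is not truncated.\<close>

lemma card_pivots_wt_le: "i \<le> m \<Longrightarrow> card (pivots m \<F> i) * wt m i \<le> card \<F>"
proof -
  assume "i \<le> m"
  have "card (pivots m \<F> i) \<le> card {A \<in> traces m \<F>. card A = i}"
    using finite_subset[OF traces_subset finite_lev] by (intro card_mono) (auto simp: pivots_def)
  then have "card (pivots m \<F> i) * wt m i \<le> card {A \<in> traces m \<F>. card A = i} * wt m i"
    by (rule mult_le_mono1)
  also have "\<dots> \<le> (\<Sum>s\<le>m. card {A \<in> traces m \<F>. card A = s} * wt m s)"
    using \<open>i \<le> m\<close> by (intro member_le_sum) auto
  finally show ?thesis using card_levels by simp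
qed

end

section \<open>Comparing both ways of moving the last point\<close>

text \<open>\<open>a\<close>, \<open>b\<close> are the family sizes, \<open>p\<close>,
  \<open>q\<close> the parts carried by the critical traces and \<open>P\<close>, \<open>Q\<close>
  the gains from deleting \<open>m\<close>. \<open>PN\<close> and \<open>QN\<close> are the exchange
  rates from \<open>wt_step\<close>.\<close>

lemma push_algebra:
  fixes a b p q P Q N N' e e' :: int
  assumes A: "(a + P) * (b - q) \<le> a * b" and B: "(b + Q) * (a - p) \<le> b * a"
    and PN: "e' * P = N * p" and QN: "e * Q = N' * q" and L: "N + e' = N' + e"
    and pos: "0 < p" "0 < q" "0 < e" "0 < e'" "0 \<le> P" "0 < N"
  shows "a * (N - e) \<le> p * N"
proof -
  \<comment> \<open>The two exchange conditions are multiplied up so that \<open>b\<close> can be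
    eliminated.\<close>
  have "P * b \<le> q * (a + P)" using A by (simp add: algebra_simps)
  then have "p * (P * b) \<le> p * (q * (a + P))" using pos by simp
  moreover have "Q * a \<le> p * (b + Q)" using B by (simp add: algebra_simps)
  then have "P * (Q * a) \<le> P * (p * (b + Q))" using pos by (intro mult_left_mono) auto
  ultimately have "P * Q * a \<le> p * q * (a + P) + p * P * Q" by (simp add: algebra_simps)
  then have le: "(e * e') * (P * Q * a) \<le> (e * e') * (p * q * (a + P) + p * P * Q)"
    using pos by (intro mult_left_mono) auto
  have "(p * q) * (N * N' * a) = (e' * P) * (e * Q) * a" unfolding PN QN by (simp add: algebra_simps)
  also have "\<dots> = (e * e') * (P * Q * a)" by (simp add: algebra_simps)
  also note le
  also have "(e * e') * (p * q * (a + P) + p * P * Q)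
      = p * q * (e * e' * a + e * (e' * P)) + p * (e' * P) * (e * Q)" by (simp add: algebra_simps)
  also have "\<dots> = (p * q) * (e * e' * a + e * N * p + p * N * N')"
    unfolding PN QN by (simp add: algebra_simps)
  finally have "(p * q) * (N * N' * a) \<le> (p * q) * (e * e' * a + e * N * p + p * N * N')" .
  then have "N * N' * a \<le> e * e' * a + e * N * p + p * N * N'" using pos by simp
  moreover have N': "N' = N + e' - e" using L by simp
  \<comment> \<open>After substituting \<open>N' = N + e' - e\<close>, both sides contain the factor
    \<open>N + e'\<close>.\<close>
  ultimately have "(N + e') * (a * (N - e)) \<le> (N + e') * (p * N)" unfolding N' by (simp add: algebra_simps)
  then show ?thesis using pos by simp
qed

lemma int_push:
  fixes a b c p q :: nat
  assumes "(a + p) * (b - q) \<le> a * c" "q \<le> b"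
  shows "(int a + int p) * (int b - int q) \<le> int a * int c"
proof -
  have "int ((a + p) * (b - q)) \<le> int (a * c)" using assms(1) by (rule of_nat_mono)
  then show ?thesis unfolding of_nat_mult of_nat_add of_nat_diff[OF assms(2)] .
qed

lemma ratio_le:
  fixes c d u v r :: nat
  assumes "c * u = d * v" "r * c \<le> d" "0 < c"
  shows "r * v \<le> u"
proof -
  have "c * (r * v) \<le> c * u"
    unfolding assms(1) using mult_le_mono1[OF assms(2), of v] by (simp add: mult_ac)
  then show ?thesis using assms(3) by simp
qed

lemma ratio_less:
  fixes c d u v r :: nat
  assumes "c * u = d * v" "r * c < d" "0 < c" "0 < v"
  shows "r * v < u"
proof -
  have "(r * c) * v < d * v" using assms(2,4) by simp
  then have "c * (r * v) < c * u" unfolding assms(1) by (simp add: mult_ac)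
  then show ?thesis using assms(3) by simp
qed

context shifted_optimum
begin

text \<open>Neither exchange improves the product, so the critical traces of size \<open>i\<close>
  carry at least the share \<open>(n + 1 - 2 * k) / (n - k + 2 - j)\<close> of
  \<open>\<F>\<close>.\<close>

lemma threshold:
  assumes ij: "i + j = m + 2" "2 \<le> i" "2 \<le> j" "i \<le> k" "j \<le> k"
    and xy: "pivots m \<F> i \<noteq> {}" "pivots m \<G> j \<noteq> {}"
  shows "int (card \<F>) * (int n + 1 - 2 * int k)
    \<le> int (card (pivots m \<F> i) * wt m i) * (int n - int k + 2 - int j)"
proof -
  interpret sym: shifted_optimum n k \<G> \<F> m by (rule sym)
  let ?p = "card (pivots m \<F> i) * wt m i" and ?q = "card (pivots m \<G> j) * wt m j"
  let ?P = "card (pivots m \<F> i) * wt m (i - 1)" and ?Q = "card (pivots m \<G> j) * wt m (j - 1)"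
  have ijm: "i \<le> m" "j \<le> m" using ij by auto
  have fin: "finite (pivots m \<H> s)" for \<H> s
    using finite_subset[OF traces_subset finite_lev] by (auto simp: pivots_def)
  have pq: "0 < ?p" "0 < ?q"
    using xy fin ij wt_pos[OF _ _ m_le(1)] by (auto simp: card_gt_0_iff)
  have le: "?p \<le> card \<F>" "?q \<le> card \<G>"
    using card_pivots_wt_le[OF ijm(1)] sym.card_pivots_wt_le[OF ijm(2)] by auto
  have nat_num: "n + i - m - k = n + 2 - j - k" "n + j - m - k = n + 2 - i - k" using ij by auto
  have nk: "2 * k \<le> n + 1" using n3 m_le by simp
  have "(int (card \<F>) + int ?P) * (int (card \<G>) - int ?q) \<le> int (card \<F>) * int (card \<G>)"
    by (rule int_push[OF push le(2)]) (use ij in auto)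
  moreover have "(int (card \<G>) + int ?Q) * (int (card \<F>) - int ?p) \<le> int (card \<G>) * int (card \<F>)"
    by (rule int_push[OF sym.push le(1)]) (use ij in auto)
  moreover have "(int k + 1 - int i) * int ?P = (int n - int k + 2 - int j) * int ?p"
  proof -
    have "(k + 1 - i) * ?P = (n + 2 - j - k) * ?p"
      using wt_step[of i m] ij m_le nat_num by (simp add: mult.left_commute)
    then have "int ((k + 1 - i) * ?P) = int ((n + 2 - j - k) * ?p)" by (rule arg_cong)
    moreover have "int (k + 1 - i) = int k + 1 - int i" "int (n + 2 - j - k) = int n - int k + 2 - int j"
      using ij nk by auto
    ultimately show ?thesis by (simp only: of_nat_mult)
  qed
  moreover have "(int k + 1 - int j) * int ?Q = (int n - int k + 2 - int i) * int ?q"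
  proof -
    have "(k + 1 - j) * ?Q = (n + 2 - i - k) * ?q"
      using wt_step[of j m] ij m_le nat_num by (simp add: mult.left_commute)
    then have "int ((k + 1 - j) * ?Q) = int ((n + 2 - i - k) * ?q)" by (rule arg_cong)
    moreover have "int (k + 1 - j) = int k + 1 - int j" "int (n + 2 - i - k) = int n - int k + 2 - int i"
      using ij nk by auto
    ultimately show ?thesis by (simp only: of_nat_mult)
  qed
  \<comment> \<open>Here \<open>N = n - k + 2 - j\<close>, \<open>e = k + 1 - j\<close>,
    \<open>N' = n - k + 2 - i\<close> and \<open>e' = k + 1 - i\<close>; both \<open>N + e'\<close>
    and \<open>N' + e\<close> equal \<open>n + 3 - i - j\<close>.\<close>
  ultimately have "int (card \<F>) * ((int n - int k + 2 - int j) - (int k + 1 - int j))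
      \<le> int ?p * (int n - int k + 2 - int j)"
    by (rule push_algebra) (use ij nk pq in linarith)+
  then show ?thesis by (simp add: algebra_simps)
qed

text \<open>The opposite bound on the same share: critical traces are at most \<open>i / m\<close>
  of level \<open>i\<close>, and the upper shadow of level \<open>i\<close> forces a large level
  \<open>i + 1\<close>, whose weight also counts towards \<open>\<F>\<close>.\<close>

lemma two_levels:
  assumes "2 \<le> i" "i < m" "i \<le> k" "i + j = m + 2" "j \<le> k"
  shows "int (card (pivots m \<F> i) * wt m i) * (int m *
      ((int i + 1) * (int n - int k + 3 - int j) + (int j - 2) * (int k - int i)))
    \<le> int (card \<F>) * (int i * (int i + 1) * (int n - int k + 3 - int j))"
proof -
  define x a c w v where "x = int (card (pivots m \<F> i))"
    and "a = int (card {A \<in> traces m \<F>. card A = i})" and "c = int (card {A \<in> traces m \<F>. card A = i + 1})"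
    and "w = int (wt m i)" and "v = int (wt m (i + 1))"
  define M where "M = int n - int k + 3 - int j"
  have M: "0 \<le> M" using n3 assms m_le unfolding M_def by linarith
  have nn: "0 \<le> x" "0 \<le> a" "0 \<le> c" "0 \<le> w" "0 \<le> v" by (simp_all add: x_def a_def c_def w_def v_def)
  have 1: "x * int m \<le> a * int i"
    using card_pivots_level[of i] assms unfolding x_def a_def of_nat_mult[symmetric] of_nat_le_iff by simp
  \<comment> \<open>The factor \<open>k - i\<close> covers \<open>i = k\<close>, where no next level
    exists and both sides vanish; the same happens in the following identity.\<close>
  have 2: "a * (int m - int i) * (int k - int i) \<le> c * (int i + 1) * (int k - int i)"
  proof (cases "i = k")
    case False
    then have "card {A \<in> traces m \<F>. card A = i} * (m - i) \<le> card {A \<in> traces m \<F>. card A = i + 1} * (i + 1)"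
      using card_next_level[of i] assms by simp
    then have "int (card {A \<in> traces m \<F>. card A = i} * (m - i)) \<le> int (card {A \<in> traces m \<F>. card A = i + 1} * (i + 1))"
      by (rule of_nat_mono)
    moreover have "int (m - i) = int m - int i" "int (i + 1) = int i + 1" using assms by auto
    ultimately have "a * (int m - int i) \<le> c * (int i + 1)"
      unfolding a_def c_def by (simp only: of_nat_mult)
    then show ?thesis using assms by (intro mult_right_mono) auto
  qed simp
  have 3: "(int k - int i) * w = M * v"
  proof (cases "i = k")
    case True
    then show ?thesis by (simp add: v_def wt_def)
  next
    case False
    then have "(k - i) * wt m i = (n + (i + 1) - m - k) * wt m (i + 1)"
      using wt_step[of "i + 1" m] assms m_le by simp
    then have "int ((k - i) * wt m i) = int ((n + (i + 1) - m - k) * wt m (i + 1))" by (rule arg_cong)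
    moreover have "int (k - i) = int k - int i" "int (n + (i + 1) - m - k) = M"
      using assms n3 m_le unfolding M_def by auto
    ultimately show ?thesis unfolding w_def v_def by (simp only: of_nat_mult)
  qed
  have "card {A \<in> traces m \<F>. card A = i} * wt m i + card {A \<in> traces m \<F>. card A = i + 1} * wt m (i + 1)
      = (\<Sum>s\<in>{i, i + 1}. card {A \<in> traces m \<F>. card A = s} * wt m s)" by simp
  also have "\<dots> \<le> card \<F>" unfolding card_levels using assms by (intro sum_mono2) auto
  finally have 4: "a * w + c * v \<le> int (card \<F>)"
    unfolding a_def c_def w_def v_def of_nat_mult[symmetric] of_nat_add[symmetric] of_nat_le_iff .
  have "x * int m * ((int m - int i) * (int k - int i) * w) \<le> a * int i * ((int m - int i) * (int k - int i) * w)"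
    by (rule mult_right_mono[OF 1]) (use nn assms in simp)
  also have "\<dots> = (a * (int m - int i) * (int k - int i)) * (int i * w)" by (simp add: algebra_simps)
  also have "\<dots> \<le> (c * (int i + 1) * (int k - int i)) * (int i * w)"
    by (rule mult_right_mono[OF 2]) (use nn in simp)
  also have "\<dots> = (c * (int i + 1)) * int i * ((int k - int i) * w)" by (simp add: algebra_simps)
  also have "\<dots> = (c * v) * (int i * (int i + 1) * M)" unfolding 3 by (simp add: algebra_simps)
  finally have 5: "x * int m * ((int m - int i) * (int k - int i) * w) \<le> (c * v) * (int i * (int i + 1) * M)" .
  have "x * int m * ((int i + 1) * M * w) \<le> a * int i * ((int i + 1) * M * w)"
    by (rule mult_right_mono[OF 1]) (use nn M in simp)
  with 5 have "x * w * (int m * ((int i + 1) * M + (int m - int i) * (int k - int i)))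
      \<le> (a * w + c * v) * (int i * (int i + 1) * M)" by (simp add: algebra_simps)
  also have "\<dots> \<le> int (card \<F>) * (int i * (int i + 1) * M)"
    by (rule mult_right_mono[OF 4]) (use M in simp)
  finally have "x * w * (int m * ((int i + 1) * M + (int m - int i) * (int k - int i)))
    \<le> int (card \<F>) * (int i * (int i + 1) * M)" .
  moreover have "int m - int i = int j - 2" using assms by linarith
  ultimately show ?thesis unfolding M_def x_def w_def by simp
qed

text \<open>Multiplying \<open>two_levels\<close> by \<open>n + 1 - 2 * k\<close> and inserting
  \<open>threshold\<close> gives the reverse of the strict numerical bound, after cancelling the
  positive weight of the critical traces.\<close>

lemma generic_contradiction:
  assumes ij: "i + j = m + 2" "2 \<le> i" "i \<le> j" "j \<le> k"
    and xy: "pivots m \<F> i \<noteq> {}" "pivots m \<G> j \<noteq> {}"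
    and gen: "(i, j) \<noteq> (2, 3)" "(i, j) \<noteq> (3, 3)" "(i, j) \<noteq> (4, 4)"
  shows False
proof -
  define N where "N = int n - int k + 2 - int j"
  let ?a = "int (card \<F>)" and ?p = "int (card (pivots m \<F> i) * wt m i)"
  have N: "2 * int k - 1 - int j \<le> N" using n3 k2 unfolding N_def by linarith
  have fin: "finite (pivots m \<F> i)"
    using finite_subset[OF traces_subset finite_lev] by (auto simp: pivots_def)
  have p: "0 < ?p" using xy fin ij wt_pos[OF _ _ m_le(1), of i] by (auto simp: card_gt_0_iff)
  have im: "i < m" using ij m by linarith
  have mi: "int m = int i + int j - 2" using ij by linarith
  let ?B = "(int i + 1) * (N + 1) + (int j - 2) * (int k - int i)"
  have num: "int i * (int i + 1) * (N + 1) * N < (N - (int k - int j + 1)) * (int i + int j - 2) * ?B"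
  proof -
    \<comment> \<open>The pair (2, 2) would give \<open>m = 2\<close>, so only the three exceptional
      pairs fall outside these ranges.\<close>
    consider "i + 2 \<le> j" | "j = i + 1" "3 \<le> i" | "j = i" "5 \<le> i"
      using ij gen m by fastforce
    then show ?thesis
    proof cases
      case 1
      then show ?thesis using ij N by (intro exchange_bound_wide) auto
    next
      case 2
      then show ?thesis using ij N by (intro exchange_bound_succ) auto
    next
      case 3
      then show ?thesis using ij N by (intro exchange_bound_equal) auto
    qed
  qed
  have e: "N - (int k - int j + 1) = int n + 1 - 2 * int k" "int n - int k + 3 - int j = N + 1"
    unfolding N_def by auto
  have e0: "0 \<le> int n + 1 - 2 * int k" using n3 k2 by linarith
  have N0: "0 \<le> N" using N ij by linarith
  have "?p * (int i * (int i + 1) * (N + 1) * N) < ?p * ((N - (int k - int j + 1)) * (int i + int j - 2) * ?B)"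
    using num p by (rule mult_strict_left_mono)
  also have "\<dots> = (int n + 1 - 2 * int k) * (?p * (int m * ?B))"
    unfolding e mi by (simp add: algebra_simps)
  also have "\<dots> \<le> (int n + 1 - 2 * int k) * (?a * (int i * (int i + 1) * (N + 1)))"
    using two_levels[of i j] ij im e0 unfolding e by (intro mult_left_mono) auto
  also have "\<dots> = (?a * (int n + 1 - 2 * int k)) * (int i * (int i + 1) * (N + 1))"
    by (simp add: algebra_simps)
  also have "\<dots> \<le> (?p * N) * (int i * (int i + 1) * (N + 1))"
    using threshold[of i j] ij xy N0 unfolding N_def by (intro mult_right_mono) auto
  finally show False by (simp add: algebra_simps)
qed

end

section \<open>Traces on three, four and six points\<close>

text \<open>To be read with \<open>s = wt 4 3\<close>, \<open>t = wt 4 4\<close> and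
  \<open>2 * s + r = wt 4 2\<close>; the right side is then the square of \<open>S\<close>. The
  factors 1 match the level counts in \<open>case_four_with_pair\<close>.\<close>

lemma product_bound_four:
  fixes r s t :: nat
  assumes "0 < s"
  shows "(1 * (2 * s + r) + 4 * s + 1 * t) * (2 * s + t) < (2 * s + r + 2 * s + t)\<^sup>2"
proof -
  have "(2 * s + r + 2 * s + t)\<^sup>2
      = (1 * (2 * s + r) + 4 * s + 1 * t) * (2 * s + t) + (4 * s * s + r * r + 6 * s * r + r * t)"
    by (simp add: power2_eq_square algebra_simps)
  then show ?thesis using assms by simp
qed

context shifted_optimum
begin

abbreviation L :: "nat \<Rightarrow> nat" where
  "L s \<equiv> card {A \<in> traces m \<F>. card A = s}"

lemma finite_traces: "finite (traces m \<H>)"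
  using finite_subset[OF traces_subset finite_lev] .

lemma level_le: "L s \<le> m choose s"
  by (rule card_level_le[OF traces_subset])

lemma level_small: "s < 2 \<Longrightarrow> L s = 0"
  using mem_traces by (fastforce simp: finite_traces)

lemma card_levels_3: "m = 3 \<Longrightarrow> card \<F> = L 2 * wt m 2 + L 3 * wt m 3"
proof -
  assume "m = 3"
  then have "{..m} = {0, 1, 2, 3}" by auto
  then show ?thesis using level_small[of 0] level_small[of 1] by (simp add: card_levels)
qed

lemma card_levels_4: "m = 4 \<Longrightarrow> card \<F> = L 2 * wt m 2 + L 3 * wt m 3 + L 4 * wt m 4"
proof -
  assume "m = 4"
  then have "{..m} = {0, 1, 2, 3, 4}" by auto
  then show ?thesis using level_small[of 0] level_small[of 1] by (simp add: card_levels)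
qed

lemma card_levels_6: "m = 6 \<Longrightarrow>
  card \<F> = L 2 * wt m 2 + L 3 * wt m 3 + L 4 * wt m 4 + L 5 * wt m 5 + L 6 * wt m 6"
proof -
  assume "m = 6"
  then have "{..m} = {0, 1, 2, 3, 4, 5, 6}" by auto
  then show ?thesis using level_small[of 0] level_small[of 1] by (simp add: card_levels)
qed

text \<open>The smaller point is shifted down to 1, then the larger one to 2.\<close>

lemma pair_mem_traces:
  assumes "C \<in> traces m \<F>" "card C = 2"
  shows "{1, 2} \<in> traces m \<F>"
proof -
  obtain c d where cd: "C = {c, d}" "c < d"
    using assms(2) by (metis card_2_iff doubleton_eq_iff linorder_neqE_nat)
  have c: "1 \<le> c" using mem_traces[OF assms(1)] cd by auto
  have 1: "{1, d} \<in> traces m \<F>"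
  proof (cases "c = 1")
    case True
    then show ?thesis using assms cd by simp
  next
    case False
    then have "swap_in 1 c C = {1, d}" "1 \<notin> C" "c \<in> C" "1 < c" using cd c by (auto simp: swap_in_def)
    then show ?thesis using traces_swap[OF assms(1), of 1 c] by simp
  qed
  show ?thesis
  proof (cases "d = 2")
    case False
    then have "swap_in 2 d {1, d} = {1, 2}" "2 \<notin> {1, d}" "2 < d" using cd c by (auto simp: swap_in_def)
    then show ?thesis using traces_swap[OF 1, of 2 d] by simp
  qed (use 1 in simp)
qed

text \<open>The only trace of \<open>\<G>\<close> is {1, 2, 3}. Writing \<open>x = wt 3 2\<close>
  and \<open>y = wt 3 3\<close>, the product is at most \<open>(3 * x + y) * y\<close>, which is
  below the square of \<open>S = x + y\<close> because \<open>y < x\<close>.\<close>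

lemma case_three:
  assumes m3: "m = 3" and B: "{1, 2, 3} \<in> traces m \<G>" "{1, 2} \<notin> traces m \<G>"
  shows False
proof -
  interpret sym: shifted_optimum n k \<G> \<F> m by (rule sym)
  have "sym.L 2 = 0" using sym.pair_mem_traces B(2) by (auto simp: sym.finite_traces)
  then have "card \<G> \<le> 1 * wt m 3"
    unfolding sym.card_levels_3[OF m3] using sym.level_le[of 3] m3 by (auto intro!: mult_le_mono1)
  then have b: "card \<G> \<le> wt 3 3" using m3 by simp
  have "L 2 \<le> 3" "L 3 \<le> 1" using level_le[of 2] level_le[of 3] m3 by (simp_all add: choose_two)
  then have a: "card \<F> \<le> 3 * wt 3 2 + 1 * wt 3 3"
    unfolding card_levels_3[OF m3] m3 by (intro add_mono mult_le_mono1)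
  have k: "3 \<le> k" and pos: "0 < wt 3 3" using m_le wt_pos[of 3 3] m3 by auto
  have "(k - 2) * wt 3 2 = (n - k) * wt 3 3" using wt_step[of 3 3] k m_le m3 by simp
  then have w: "1 * wt 3 3 < wt 3 2" by (rule ratio_less) (use k n3 pos in auto)
  have "card \<F> * card \<G> \<le> (3 * wt 3 2 + 1 * wt 3 3) * wt 3 3" by (rule mult_le_mono[OF a b])
  also have "\<dots> < (wt 3 2 + wt 3 3)\<^sup>2"
    using mult_strict_right_mono[OF w, of "wt 3 2"] w by (simp add: power2_eq_square algebra_simps)
  also have "\<dots> = S\<^sup>2" by (simp add: S_wt3)
  finally show False using S_le by simp
qed

text \<open>The ratio of the first two weights is \<open>(n - k - 1) / (k - 2)\<close>; it equals 2
  only at \<open>n = 3 * (k - 1)\<close>, which is where the second extremal family ties with the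
  star.\<close>

lemma weights_four:
  assumes m4: "m = 4"
  shows "2 * wt 4 3 \<le> wt 4 2" "n > 3 * (k - 1) \<Longrightarrow> 2 * wt 4 3 < wt 4 2" "0 < wt 4 3"
    "S = wt 4 2 + 2 * wt 4 3 + wt 4 4"
proof -
  have k: "3 \<le> k" using m_le by simp
  have n4: "4 \<le> n" using m_le m4 by simp
  show pos: "0 < wt 4 3" using wt_pos[of 3 4] k m_le m4 by auto
  have eq: "(k - 2) * wt 4 2 = (n - k - 1) * wt 4 3" using wt_step[of 3 4] k n4 by (simp add: diff_diff_add add.commute)
  show "2 * wt 4 3 \<le> wt 4 2" by (rule ratio_le[OF eq]) (use k n3 in auto)
  show "2 * wt 4 3 < wt 4 2" if "n > 3 * (k - 1)" by (rule ratio_less[OF eq]) (use k that pos in auto)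
  show "S = wt 4 2 + 2 * wt 4 3 + wt 4 4" by (rule S_wt4[OF n4])
qed

text \<open>All traces of \<open>\<G>\<close> contain {1, 2}, so the critical one is {1, 2, 4} and
  {1, 2} itself is no trace of \<open>\<G>\<close>. By stability {1, 2, 3} is one too, which leaves
  {1, 2} as the only 2-point trace of \<open>\<F>\<close>; the resulting product is too
  small.\<close>

lemma case_four_with_pair:
  assumes m4: "m = 4" and P: "{1, 2} \<in> traces m \<F>" and top: "B \<in> pivots m \<G> 3"
  shows False
proof -
  interpret sym: shifted_optimum n k \<G> \<F> m by (rule sym)
  have sub: "{1, 2} \<subseteq> D" if "D \<in> traces m \<G>" for D
  proof -
    have "2 \<le> card ({1, 2} \<inter> D)" using cross_traces P that unfolding cross_intersecting_def by blast
    then have "{1, 2} \<inter> D = {1, 2}" by (intro card_seteq) auto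
    then show ?thesis by blast
  qed
  have B: "B \<in> traces m \<G>" "card B = 3" "4 \<in> B" "B - {4} \<notin> traces m \<G>" using top m4 by (auto simp: pivots_def)
  have "{1, 2, 4} \<subseteq> B" using sub[OF B(1)] B by simp
  then have Beq: "{1, 2, 4} = B" using B by (intro card_seteq) (auto simp: sym.mem_traces)
  have "B - {4} = {1, 2}" unfolding Beq[symmetric] by auto
  then have no: "{1, 2} \<notin> traces m \<G>" using B(4) by simp
  have B': "{1, 2, 3} \<in> traces m \<G>"
  proof -
    have "swap_in 3 4 B = {1, 2, 3}" unfolding Beq[symmetric] by (auto simp: swap_in_def)
    then show ?thesis using sym.traces_swap[OF B(1), of 3 4] Beq by auto
  qed
  have "sym.L 2 = 0" using sym.pair_mem_traces no by (auto simp: sym.finite_traces)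
  moreover have "sym.L 3 \<le> 2"
  proof -
    have "{A \<in> traces m \<G>. card A = 3} \<subseteq> {{1, 2, 3}, {1, 2, 4}}"
    proof
      fix A assume "A \<in> {A \<in> traces m \<G>. card A = 3}"
      then have A: "A \<in> traces m \<G>" "card A = 3" by auto
      then have A': "{1, 2} \<subseteq> A" "A \<subseteq> {1..4}" "finite A" using sub sym.mem_traces[OF A(1)] m4 by auto
      then have "card (A - {1, 2}) = 1" using A by (simp add: card_Diff_subset)
      then obtain v where v: "A - {1, 2} = {v}" by (metis card_1_singletonE)
      then have "v \<in> {1..4} - {1, 2}" "A = {1, 2, v}" using A'(1,2) by blast+
      then have "v = 3 \<or> v = 4" by auto
      then show "A \<in> {{1, 2, 3}, {1, 2, 4}}" using \<open>A = {1, 2, v}\<close> by auto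
    qed
    then have "sym.L 3 \<le> card {{1, 2, 3}, {1, 2, 4::nat}}" by (intro card_mono) auto
    also have "\<dots> \<le> 2" by (simp add: card_insert_if)
    finally show ?thesis .
  qed
  moreover have "sym.L 4 \<le> 1" using sym.level_le[of 4] m4 by simp
  ultimately have "card \<G> \<le> 0 * wt 4 2 + 2 * wt 4 3 + 1 * wt 4 4"
    unfolding sym.card_levels_4[OF m4] m4 by (intro add_mono mult_le_mono1) auto
  then have b: "card \<G> \<le> 2 * wt 4 3 + wt 4 4" by simp
  have "L 2 \<le> 1"
  proof -
    have "{A \<in> traces m \<F>. card A = 2} \<subseteq> {{1, 2}}"
    proof
      fix A assume "A \<in> {A \<in> traces m \<F>. card A = 2}"
      then have A: "A \<in> traces m \<F>" "card A = 2" "finite A" using mem_traces by auto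
      have "A \<subseteq> D" if "D \<in> traces m \<G>" for D
      proof -
        have "2 \<le> card (A \<inter> D)" using cross_traces A that unfolding cross_intersecting_def by blast
        then have "A \<inter> D = A" using A by (intro card_seteq) auto
        then show ?thesis by blast
      qed
      from this[OF B(1)] this[OF B'] have "A \<subseteq> {1, 2}" unfolding Beq[symmetric] by auto
      then have "A = {1, 2}" using A by (intro card_seteq) auto
      then show "A \<in> {{1, 2}}" by simp
    qed
    then have "L 2 \<le> card {{1, 2::nat}}" by (intro card_mono) auto
    then show ?thesis by simp
  qed
  moreover have "L 3 \<le> 4" "L 4 \<le> 1"
    using level_le[of 3] level_le[of 4] m4 by (simp_all add: eval_nat_numeral)
  ultimately have a: "card \<F> \<le> 1 * wt 4 2 + 4 * wt 4 3 + 1 * wt 4 4"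
    unfolding card_levels_4[OF m4] m4 by (intro add_mono mult_le_mono1)
  define r where "r = wt 4 2 - 2 * wt 4 3"
  have w: "wt 4 2 = 2 * wt 4 3 + r" "0 < wt 4 3"
    using weights_four[OF m4] by (auto simp: r_def)
  have "card \<F> * card \<G> \<le> (1 * wt 4 2 + 4 * wt 4 3 + 1 * wt 4 4) * (2 * wt 4 3 + wt 4 4)"
    by (rule mult_le_mono[OF a b])
  also have "\<dots> < (wt 4 2 + 2 * wt 4 3 + wt 4 4)\<^sup>2"
    unfolding w(1) by (rule product_bound_four[OF w(2)])
  also have "\<dots> = S\<^sup>2" using weights_four[OF m4] by simp
  finally show False using S_le by simp
qed

lemma case_four_no_pair:
  assumes m4: "m = 4" and no: "{1, 2} \<notin> traces m \<F>"
  shows "card \<F> \<le> 4 * wt 4 3 + wt 4 4" "\<F> \<subseteq> core_family n k {1..4} 3"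
proof -
  have no2: "card A \<noteq> 2" if "A \<in> traces m \<F>" for A using pair_mem_traces that no by blast
  then have "L 2 = 0" by (auto simp: finite_traces)
  moreover have "L 3 \<le> 4" "L 4 \<le> 1"
    using level_le[of 3] level_le[of 4] m4 by (simp_all add: eval_nat_numeral)
  ultimately have "card \<F> \<le> 0 * wt 4 2 + 4 * wt 4 3 + 1 * wt 4 4"
    unfolding card_levels_4[OF m4] m4 by (intro add_mono mult_le_mono1) auto
  then show "card \<F> \<le> 4 * wt 4 3 + wt 4 4" by simp
  show "\<F> \<subseteq> core_family n k {1..4} 3"
  proof
    fix A assume A: "A \<in> \<F>"
    then have "A \<inter> {1..4} \<in> traces m \<F>" using subset_lift_traces[OF F] m4 by (auto simp: lift_def)
    then have "2 \<le> card (A \<inter> {1..4})" "card (A \<inter> {1..4}) \<noteq> 2" using mem_traces no2 by auto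
    then show "A \<in> core_family n k {1..4} 3" using A F by (auto simp: core_family_def)
  qed
qed

lemma card_core_four_le:
  assumes "m = 4"
  shows "card (core_family n k {1..4} 3) \<le> 4 * wt 4 3 + wt 4 4"
proof -
  let ?A = "{A \<in> lev 4. 3 \<le> card A}"
  have "card (H \<inter> {1..4}) \<le> k" if "H \<in> nsets {1..n} k" for H
    using that card_mono[of H "H \<inter> {1..4}"] by (auto simp: nsets_def)
  then have eq: "core_family n k {1..4} 3 = lift 4 ?A" by (auto simp: core_family_def lift_def lev_def)
  have "{..4} = {0, 1, 2, 3, 4::nat}" by auto
  then have "card (lift 4 ?A) = card {A \<in> ?A. card A = 3} * wt 4 3 + card {A \<in> ?A. card A = 4} * wt 4 4"
    using card_lift_levels[of 4 ?A] m_le assms by (simp cong: conj_cong)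
  also have "\<dots> \<le> (4 choose 3) * wt 4 3 + (4 choose 4) * wt 4 4"
    by (intro add_mono mult_le_mono1 card_level_le) auto
  also have "4 choose 3 = (4::nat)" by (simp add: eval_nat_numeral)
  finally have "card (lift 4 ?A) \<le> 4 * wt 4 3 + wt 4 4" by simp
  then show ?thesis using eq by simp
qed

text \<open>Without 2-point traces both sizes are at most \<open>4 * wt 4 3 + wt 4 4\<close>, which
  is at most \<open>S\<close>. Optimality forces equality throughout, hence
  \<open>wt 4 2 = 2 * wt 4 3\<close> and \<open>n = 3 * (k - 1)\<close>.\<close>

lemma case_four:
  assumes m4: "m = 4" and top: "pivots m \<F> 3 \<noteq> {}" "pivots m \<G> 3 \<noteq> {}"
  shows "n = 3 * (k - 1) \<and> \<F> = core_family n k {1..4} 3 \<and> \<G> = core_family n k {1..4} 3 \<and>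
    card \<F> = S \<and> card \<G> = S"
proof -
  interpret sym: shifted_optimum n k \<G> \<F> m by (rule sym)
  have no: "{1, 2} \<notin> traces m \<F>" "{1, 2} \<notin> traces m \<G>"
    using case_four_with_pair[OF m4] sym.case_four_with_pair[OF m4] top by auto
  let ?c = "4 * wt 4 3 + wt 4 4"
  note F4 = case_four_no_pair[OF m4 no(1)] and G4 = sym.case_four_no_pair[OF m4 no(2)]
  have cS: "?c \<le> S" using weights_four[OF m4] by simp
  have "S\<^sup>2 \<le> ?c * ?c" using S_le mult_le_mono[OF F4(1) G4(1)] by linarith
  then have "S \<le> ?c" unfolding power2_eq_square[symmetric] using power2_nat_le_eq_le by blast
  then have Sc: "S = ?c" using cS by (rule le_antisym)
  have n: "n = 3 * (k - 1)"
  proof (rule ccontr)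
    assume "n \<noteq> 3 * (k - 1)"
    then have "2 * wt 4 3 < wt 4 2" using weights_four(2)[OF m4] n3 by simp
    then show False using weights_four(4)[OF m4] Sc by linarith
  qed
  have aS: "card \<F> \<le> S" "card \<G> \<le> S" using F4 G4 Sc by auto
  have "S * S \<le> card \<F> * card \<G>" using S_le by (simp add: power2_eq_square)
  note factors_eq_max[OF this aS S_pos]
  then have aeq: "card \<F> = S" "card \<G> = S" by auto
  have "\<F> = core_family n k {1..4} 3" "\<G> = core_family n k {1..4} 3"
    using card_core_four_le[OF m4] aeq Sc
    by (auto intro!: card_seteq[OF finite_core_family F4(2)] card_seteq[OF finite_core_family G4(2)]
      simp del: One_nat_def)
  then show ?thesis using n aeq by blast
qed

text \<open>In the expansion of \<open>S\<close> the first two terms exceed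
  \<open>10 * wt 6 4\<close>, and one copy of \<open>wt 6 4\<close> pays for two more copies of
  \<open>wt 6 5\<close>.\<close>

lemma weights_six:
  assumes m6: "m = 6" and k4: "4 \<le> k"
  shows "15 * wt 6 4 + 6 * wt 6 5 + wt 6 6 < S"
proof -
  have n6: "6 \<le> n" using m_le m6 by simp
  have pos: "0 < wt 6 4" using wt_pos[of 4 6] k4 m_le m6 by auto
  have "(k - 2) * wt 6 2 = (n - k - 3) * wt 6 3" using wt_step[of 3 6] k4 n6 by (simp add: diff_diff_add add.commute)
  then have 1: "1 * wt 6 3 \<le> wt 6 2" by (rule ratio_le) (use k4 n3 in auto)
  have "(k - 3) * wt 6 3 = (n - k - 2) * wt 6 4" using wt_step[of 4 6] k4 n6 by (simp add: diff_diff_add add.commute)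
  then have 2: "2 * wt 6 4 < wt 6 3" by (rule ratio_less) (use k4 n3 pos in auto)
  have 3: "2 * wt 6 5 \<le> wt 6 4"
  proof (cases "k = 4")
    case True
    then have "\<not> 5 \<le> k" by simp
    then show ?thesis by (simp add: wt_def)
  next
    case False
    then have "(k - 4) * wt 6 4 = (n - k - 1) * wt 6 5" using wt_step[of 5 6] k4 n6 by (simp add: diff_diff_add add.commute)
    then show ?thesis by (rule ratio_le) (use k4 False n3 in auto)
  qed
  show ?thesis using S_wt6[OF n6] 1 2 3 by linarith
qed

text \<open>An empty level 3 empties level 2, since upper shadows of traces are traces; the
  remaining levels, even if full, weigh less than \<open>S\<close>.\<close>

lemma case_six_no_triple:
  assumes m6: "m = 6" and k4: "4 \<le> k" and no: "L 3 = 0"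
  shows "card \<F> < S"
proof -
  have "L 2 = 0" using card_next_level[of 2] m6 k4 no by simp
  moreover have "L 4 \<le> 15" "L 5 \<le> 6" "L 6 \<le> 1"
    using level_le[of 4] level_le[of 5] level_le[of 6] m6 by (simp_all add: eval_nat_numeral)
  ultimately have "card \<F> \<le> 0 * wt 6 2 + 0 * wt 6 3 + 15 * wt 6 4 + 6 * wt 6 5 + 1 * wt 6 6"
    unfolding card_levels_6[OF m6] m6 no[unfolded m6] by (intro add_mono mult_le_mono1) auto
  then show ?thesis using weights_six[OF m6 k4] by simp
qed

text \<open>One trace of size 3 supplies the missing slack twice: it lowers the possible number of
  critical traces to 9 and adds \<open>wt 6 3\<close> to the two-level bound.\<close>

lemma case_six_triple:
  assumes m6: "m = 6" and k4: "4 \<le> k" and C: "L 3 \<noteq> 0"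
    and top: "pivots m \<F> 4 \<noteq> {}" "pivots m \<G> 4 \<noteq> {}"
  shows False
proof -
  let ?X = "pivots m \<F> 4"
  obtain C where C: "C \<in> traces m \<F>" "card C = 3" using C by (metis (mono_tags, lifting) card.empty empty_Collect_eq)
  obtain D where D: "D \<in> traces m \<F>" "card D = 3" "6 \<notin> D"
  proof (cases "6 \<in> C")
    case True
    have fin: "finite C" using mem_traces[OF C(1)] by simp
    have "\<not> {1..5} \<subseteq> C" using card_mono[OF fin, of "{1..5}"] C by auto
    then obtain l where l: "l \<in> {1..5}" "l \<notin> C" by blast
    then have "swap_in l 6 C \<in> traces m \<F>" using traces_swap[OF C(1), of l 6] True by simp
    moreover have "card (swap_in l 6 C) = 3" using card_swap_in[OF fin True l(2)] C by simp
    moreover have "6 \<notin> swap_in l 6 C" using l by (auto simp: swap_in_def)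
    ultimately show ?thesis by (rule that)
  qed (use C that in blast)
  \<comment> \<open>Deleting 6 maps the critical traces injectively to the 10 triples in
    \<open>{1..5}\<close>, and never to the trace \<open>D\<close>.\<close>
  have x9: "card ?X \<le> 9"
  proof -
    note inj = inj_on_pivots[of m \<F> 4]
    have five: "A - {6} \<subseteq> {1..5}" if "A \<subseteq> {1..6}" for A :: "nat set" using that by force
    have "(\<lambda>A. A - {m}) ` ?X \<subseteq> nsets {1..5} 3 - {D}"
    proof
      fix E assume "E \<in> (\<lambda>A. A - {m}) ` ?X"
      then obtain A where A: "A \<in> traces m \<F>" "card A = 4" "6 \<in> A" "A - {6} \<notin> traces m \<F>" "E = A - {6}"
        using m6 by (auto simp: pivots_def)
      then have "finite A" "E \<subseteq> {1..5}" using mem_traces[OF A(1)] m6 five by auto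
      then show "E \<in> nsets {1..5} 3 - {D}" using A D by (auto simp: nsets_def)
    qed
    then have "card ((\<lambda>A. A - {m}) ` ?X) \<le> card (nsets {1..5} 3 - {D})"
      by (intro card_mono) (auto simp: finite_imp_finite_nsets)
    also have "D \<in> nsets {1..5} 3"
    proof -
      have "D - {6} = D" using D by simp
      then show ?thesis using mem_traces[OF D(1)] m6 five[of D] D by (auto simp: nsets_def)
    qed
    then have "card (nsets {1..5} 3 - {D}) = card (nsets {1..5::nat} 3) - 1" by simp
    also have "card (nsets {1..5::nat} 3) = 10" by (simp add: eval_nat_numeral)
    finally show ?thesis using card_image[OF inj] by simp
  qed
  define x a w3 w4 w5 l4 l5 N K where "x = int (card ?X)" and "a = int (card \<F>)"
    and "w3 = int (wt 6 3)" and "w4 = int (wt 6 4)" and "w5 = int (wt 6 5)"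
    and "l4 = int (L 4)" and "l5 = int (L 5)" and "N = int n - int k - 2" and "K = int k"
  have nn: "0 \<le> x" "x \<le> 9" "0 \<le> w3" "0 \<le> w4" "0 \<le> w5" "0 \<le> l4" "0 \<le> l5"
    using x9 by (auto simp: x_def w3_def w4_def w5_def l4_def l5_def)
  have n6: "6 \<le> n" using m_le m6 by simp
  have KN: "4 \<le> K" "2 * K - 5 \<le> N" using k4 n3 by (auto simp: K_def N_def)
  have w4: "0 < w4" using wt_pos[of 4 6] k4 m_le m6 by (auto simp: w4_def)
  have e3: "(K - 3) * w3 = N * w4"
  proof -
    have "(k - 3) * wt 6 3 = (n - k - 2) * wt 6 4" using wt_step[of 4 6] k4 n6 by (simp add: diff_diff_add add.commute)
    then have "int ((k - 3) * wt 6 3) = int ((n - k - 2) * wt 6 4)" by (rule arg_cong)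
    moreover have "int (k - 3) = K - 3" "int (n - k - 2) = N" using k4 n3 by (auto simp: K_def N_def)
    ultimately show ?thesis unfolding w3_def w4_def by (simp only: of_nat_mult)
  qed
  have e5: "(K - 4) * w4 = (N + 1) * w5"
  proof (cases "k = 4")
    case True
    then have "\<not> 5 \<le> k" "K = 4" by (simp_all add: K_def)
    then show ?thesis by (simp add: wt_def w5_def)
  next
    case False
    then have "(k - 4) * wt 6 4 = (n - k - 1) * wt 6 5" using wt_step[of 5 6] k4 n6 by (simp add: diff_diff_add add.commute)
    then have "int ((k - 4) * wt 6 4) = int ((n - k - 1) * wt 6 5)" by (rule arg_cong)
    moreover have "int (k - 4) = K - 4" "int (n - k - 1) = N + 1" using k4 n3 by (auto simp: K_def N_def)
    ultimately show ?thesis unfolding w5_def w4_def by (simp only: of_nat_mult)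
  qed
  have l4: "3 * x \<le> 2 * l4" using card_pivots_level[of 4] m6 by (simp add: x_def l4_def)
  have l5: "(2 * l4) * (K - 4) \<le> (5 * l5) * (K - 4)"
  proof (cases "k = 4")
    case False
    then have "2 * l4 \<le> 5 * l5" using card_next_level[of 4] m6 k4 by (simp add: l4_def l5_def)
    then show ?thesis using KN by (intro mult_right_mono) auto
  qed (simp add: K_def)
  have "card {D} \<le> L 3" using D finite_traces by (intro card_mono) auto
  then have "1 * wt m 3 \<le> L 3 * wt m 3" by (intro mult_le_mono1) simp
  then have "wt m 3 + L 4 * wt m 4 + L 5 * wt m 5 \<le> card \<F>" unfolding card_levels_6[OF m6] by linarith
  then have "int (wt m 3 + L 4 * wt m 4 + L 5 * wt m 5) \<le> int (card \<F>)" by (rule of_nat_mono)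
  then have a: "w3 + l4 * w4 + l5 * w5 \<le> a"
    unfolding a_def w3_def w4_def w5_def l4_def l5_def m6 by simp
  have th: "a * (N - (K - 3)) \<le> x * w4 * N"
    using threshold[of 4 4] m6 k4 top unfolding a_def x_def w4_def N_def K_def by (simp add: algebra_simps)
  let ?R = "10 * N * (N + 1) + x * (15 * (K - 3) * (N + 1) + 6 * (K - 4) * (K - 3))"
  have big: "w4 * ?R \<le> a * (10 * (K - 3) * (N + 1))"
  proof -
    have "15 * x * (w4 * (K - 3) * (N + 1)) \<le> 10 * l4 * (w4 * (K - 3) * (N + 1))"
      using l4 nn KN by (intro mult_right_mono) auto
    moreover have "6 * x * (K - 4) * (w4 * (K - 3)) \<le> 10 * l5 * (K - 4) * (w4 * (K - 3))"
    proof -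
      have "3 * x * (K - 4) \<le> (2 * l4) * (K - 4)" using l4 KN by (intro mult_right_mono) auto
      then have six: "6 * x * (K - 4) \<le> 10 * l5 * (K - 4)" using l5 by linarith
      show ?thesis by (rule mult_right_mono[OF six]) (use nn KN in simp)
    qed
    moreover have "10 * l5 * (K - 4) * (w4 * (K - 3)) = l5 * w5 * (10 * (K - 3) * (N + 1))"
    proof -
      have "10 * l5 * (K - 4) * (w4 * (K - 3)) = 10 * l5 * (K - 3) * ((K - 4) * w4)" by (simp add: algebra_simps)
      then show ?thesis unfolding e5 by (simp add: algebra_simps)
    qed
    moreover have "w4 * (10 * N * (N + 1)) = w3 * (10 * (K - 3) * (N + 1))"
    proof -
      have "w4 * (10 * N * (N + 1)) = 10 * (N + 1) * (N * w4)" by (simp add: algebra_simps)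
      then show ?thesis unfolding e3[symmetric] by (simp add: algebra_simps)
    qed
    ultimately have "w4 * ?R \<le> (w3 + l4 * w4 + l5 * w5) * (10 * (K - 3) * (N + 1))"
      by (simp add: algebra_simps)
    also have "\<dots> \<le> a * (10 * (K - 3) * (N + 1))"
      by (rule mult_right_mono[OF a]) (use KN in simp)
    finally show ?thesis .
  qed
  have "w4 * (10 * x * N * (K - 3) * (N + 1)) < w4 * ((N - (K - 3)) * ?R)"
    using exchange_bound_six[OF KN nn(1,2)] w4 by (rule mult_strict_left_mono)
  also have "\<dots> = (N - (K - 3)) * (w4 * ?R)" by (simp add: algebra_simps)
  also have "\<dots> \<le> (N - (K - 3)) * (a * (10 * (K - 3) * (N + 1)))"
    by (rule mult_left_mono[OF big]) (use KN in linarith)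
  also have "\<dots> = (a * (N - (K - 3))) * (10 * (K - 3) * (N + 1))" by (simp add: algebra_simps)
  also have "\<dots> \<le> (x * w4 * N) * (10 * (K - 3) * (N + 1))"
    by (rule mult_right_mono[OF th]) (use KN in auto)
  finally show False by (simp add: algebra_simps)
qed

lemma case_six:
  assumes m6: "m = 6" and k4: "4 \<le> k" and top: "pivots m \<F> 4 \<noteq> {}" "pivots m \<G> 4 \<noteq> {}"
  shows False
proof -
  interpret sym: shifted_optimum n k \<G> \<F> m by (rule sym)
  have "L 3 = 0" "sym.L 3 = 0" using case_six_triple[OF m6 k4] sym.case_six_triple[OF m6 k4] top by auto
  then have "card \<F> < S" "card \<G> < S" using case_six_no_triple[OF m6 k4] sym.case_six_no_triple[OF m6 k4] by auto
  then have "card \<F> * card \<G> < S * S" by (rule mult_strict_mono[OF _ _ S_pos]) simp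
  then show False using S_le by (simp add: power2_eq_square)
qed

text \<open>\<open>A\<close> and \<open>B\<close> are critical themselves, so the size pairs left
  over by \<open>generic_contradiction\<close> are the only possibilities; they belong to
  \<open>m = 3\<close>, \<open>m = 4\<close> and \<open>m = 6\<close>.\<close>

lemma ordered_conclusion:
  assumes A: "A \<in> traces m \<F>" and B: "B \<in> traces m \<G>" and mAB: "m \<in> A" "m \<in> B" "card (A \<inter> B) = 2"
    and le: "card A \<le> card B"
  shows "n = 3 * (k - 1) \<and> \<F> = core_family n k {1..4} 3 \<and> \<G> = core_family n k {1..4} 3 \<and>
    card \<F> = S \<and> card \<G> = S"
proof -
  interpret sym: shifted_optimum n k \<G> \<F> m by (rule sym)
  note AB = tight_pair_Un[OF A B mAB]
  have BA: "B - {m} \<notin> traces m \<G>" using sym.tight_pair_Un(3)[OF B A mAB(2,1)] mAB by (simp add: Int_commute)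
  have top: "pivots m \<F> (card A) \<noteq> {}" "pivots m \<G> (card B) \<noteq> {}" using A B mAB AB(3) BA by (auto simp: pivots_def)
  have cA: "2 \<le> card A" "card B \<le> k" using mem_traces[OF A] sym.mem_traces[OF B] by auto
  from generic_contradiction[OF AB(2) cA(1) le cA(2) top]
  consider "card A = 2" "card B = 3" | "card A = 3" "card B = 3" | "card A = 4" "card B = 4" by auto
  then show ?thesis
  proof cases
    case 1
    then have m3: "m = 3" using AB(2) by simp
    have "B \<subseteq> {1..3}" using sym.mem_traces[OF B] m3 by simp
    then have "B = {1..3}" using 1 by (intro card_seteq) auto
    then have "B = {1, 2, 3}" by auto
    moreover from this have "B - {3} = {1, 2}" by auto
    ultimately show ?thesis using case_three[OF m3] B BA m3 by auto
  next
    case 2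
    then have m4: "m = 4" "pivots m \<F> 3 \<noteq> {}" "pivots m \<G> 3 \<noteq> {}" using top AB(2) by auto
    show ?thesis by (rule case_four[OF m4])
  next
    case 3
    then show ?thesis using case_six top AB(2) cA by simp
  qed
qed

lemma optimum_core_four:
  "n = 3 * (k - 1) \<and> \<F> = core_family n k {1..4} 3 \<and> \<G> = core_family n k {1..4} 3 \<and>
    card \<F> = S \<and> card \<G> = S"
proof -
  interpret sym: shifted_optimum n k \<G> \<F> m by (rule sym)
  obtain A B where AB: "A \<in> traces m \<F>" "B \<in> traces m \<G>" "m \<in> A" "m \<in> B" "card (A \<inter> B) = 2"
    by (rule tight_pair)
  show ?thesis
  proof (cases "card A \<le> card B")
    case True
    then show ?thesis by (rule ordered_conclusion[OF AB])
  next
    case False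
    then have "card B \<le> card A" by simp
    moreover have "card (B \<inter> A) = 2" using AB(5) by (simp add: Int_commute)
    ultimately show ?thesis using sym.ordered_conclusion[OF AB(2,1,4,3)] by blast
  qed
qed

end

section \<open>Structure of optimal pairs\<close>

lemma star_family_eq_core_family:
  assumes "T \<in> nsets {1..n} 2"
  shows "star_family n k T = core_family n k T 2"
proof -
  have T: "finite T" "card T = 2" using assms by (auto simp: nsets_def)
  have "2 \<le> card (F \<inter> T) \<longleftrightarrow> T \<subseteq> F" for F
    using T by (metis card_seteq card_mono inf.absorb_iff2 inf_le2 order_refl)
  then show ?thesis by (auto simp: star_family_def core_family_def)
qed

context ekr_range
begin

text \<open>A common point beyond \<open>2 * k - 2\<close> can be swapped in \<open>A\<close> for a
  point outside both sets. This shrinks \<open>A \<inter> B\<close> without changing its part in the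
  initial segment, whence the induction.\<close>

lemma shifted_meet_initial:
  assumes F: "\<F> \<subseteq> nsets {1..n} k" and G: "\<G> \<subseteq> nsets {1..n} k" and sh: "shifted \<F>"
    and crs: "cross_intersecting 2 \<F> \<G>" and AB: "A \<in> \<F>" "B \<in> \<G>"
  shows "2 \<le> card (A \<inter> B \<inter> {1..2 * k - 2})"
  using AB(1)
proof (induction "card (A \<inter> B)" arbitrary: A rule: less_induct)
  case less
  have A: "A \<subseteq> {1..n}" "finite A" "card A = k" and B: "B \<subseteq> {1..n}" "finite B" "card B = k"
    using less.prems AB(2) F G by (auto simp: nsets_def)
  have two: "2 \<le> card (A \<inter> B)" using crs less.prems AB(2) by (simp add: cross_intersecting_def)
  show ?case
  proof (cases "A \<inter> B \<subseteq> {1..2 * k - 2}")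
    case True
    then have "A \<inter> B \<inter> {1..2 * k - 2} = A \<inter> B" by blast
    then show ?thesis using two by simp
  next
    case False
    then obtain c where c: "c \<in> A" "c \<in> B" "c \<notin> {1..2 * k - 2}" by blast
    then have c2: "2 * k - 2 < c" using A by auto
    \<comment> \<open>Two common points leave at most \<open>2 * k - 2\<close> points in the union,
      and \<open>c\<close> is one of them outside the segment.\<close>
    have "\<not> {1..2 * k - 2} \<subseteq> A \<union> B"
    proof
      assume "{1..2 * k - 2} \<subseteq> A \<union> B"
      then have "card (insert c {1..2 * k - 2}) \<le> card (A \<union> B)"
        using A B c by (intro card_mono) auto
      moreover have "card (A \<union> B) + card (A \<inter> B) = 2 * k" using card_Un_Int[OF A(2) B(2)] A B by simp
      ultimately show False using c two k2 by simp
    qed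
    then obtain l where l: "l \<in> {1..2 * k - 2}" "l \<notin> A" "l \<notin> B" by blast
    let ?A = "swap_in l c A"
    have A': "?A \<in> \<F>" using sh less.prems l c c2 by (simp add: shifted_def)
    have "?A \<inter> B = A \<inter> B - {c}" using l by (auto simp: swap_in_def)
    then have "card (?A \<inter> B) < card (A \<inter> B)" using A c card_Diff1_less[of "A \<inter> B" c] by simp
    from less.hyps[OF this A'] have "2 \<le> card (?A \<inter> B \<inter> {1..2 * k - 2})" .
    moreover have "?A \<inter> B \<inter> {1..2 * k - 2} = A \<inter> B \<inter> {1..2 * k - 2}"
      using l c by (auto simp: swap_in_def)
    ultimately show ?thesis by simp
  qed
qed

text \<open>The least suitable \<open>m\<close> is at most \<open>2 * k - 2\<close>. If it is at
  least 3, \<open>shifted_optimum\<close> applies; otherwise every member of either family contains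
  {1, 2}.\<close>

lemma optimal_shifted:
  assumes opt: "optimal \<F> \<G>" and sh: "shifted \<F>" "shifted \<G>"
  shows "card \<F> * card \<G> = S\<^sup>2 \<and>
    (\<F> = core_family n k {1, 2} 2 \<and> \<G> = core_family n k {1, 2} 2 \<or>
     3 \<le> k \<and> n = 3 * (k - 1) \<and> \<F> = core_family n k {1..4} 3 \<and> \<G> = core_family n k {1..4} 3)"
proof -
  have F: "\<F> \<subseteq> nsets {1..n} k" and G: "\<G> \<subseteq> nsets {1..n} k" and crs: "cross_intersecting 2 \<F> \<G>"
    using opt by (auto simp: optimal_def)
  define meets where "meets m \<longleftrightarrow> (\<forall>A\<in>\<F>. \<forall>B\<in>\<G>. 2 \<le> card (A \<inter> B \<inter> {1..m}))" for m
  define m where "m = (LEAST m. meets m)"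
  have init: "meets (2 * k - 2)"
    using shifted_meet_initial[OF F G sh(1) crs] by (auto simp: meets_def)
  have meets: "meets m" unfolding m_def by (rule LeastI[of meets, OF init])
  have m_le: "m \<le> 2 * k - 2" unfolding m_def by (rule Least_le[of meets, OF init])
  show ?thesis
  proof (cases "3 \<le> m")
    case True
    have "\<not> meets (m - 1)" using True not_less_Least[of "m - 1" meets] unfolding m_def by simp
    then have tight: "\<exists>A\<in>\<F>. \<exists>B\<in>\<G>. card (A \<inter> B \<inter> {1..m - 1}) < 2"
      unfolding meets_def by (meson not_le)
    interpret shifted_optimum n k \<F> \<G> m
      by unfold_locales (use opt sh True m_le meets tight in \<open>auto simp: meets_def\<close>)
    have "3 \<le> k" using True m_le by simp
    then show ?thesis using optimum_core_four by (auto simp: power2_eq_square)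
  next
    case False
    have sub: "{1, 2} \<subseteq> A \<inter> B" if "A \<in> \<F>" "B \<in> \<G>" for A B
    proof -
      have "2 \<le> card (A \<inter> B \<inter> {1..m})" using meets that by (auto simp: meets_def)
      also have "\<dots> \<le> card (A \<inter> B \<inter> {1, 2})" using False by (intro card_mono) auto
      finally have "A \<inter> B \<inter> {1, 2} = {1, 2}" by (intro card_seteq) auto
      then show ?thesis by blast
    qed
    obtain A B where AB: "A \<in> \<F>" "B \<in> \<G>" using optimal_pos[OF opt] by (metis card.empty ex_in_conv less_irrefl)
    have core: "H \<in> core_family n k {1, 2} 2" if "H \<in> nsets {1..n} k" "{1, 2} \<subseteq> H" for H
    proof -
      have "H \<inter> {1, 2} = {1, 2}" using that by blast
      then show ?thesis using that by (simp add: core_family_def)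
    qed
    have FS: "\<F> \<subseteq> core_family n k {1, 2} 2"
    proof
      fix H assume "H \<in> \<F>"
      then show "H \<in> core_family n k {1, 2} 2" using core[of H] sub[of H B] AB F by auto
    qed
    have GS: "\<G> \<subseteq> core_family n k {1, 2} 2"
    proof
      fix H assume "H \<in> \<G>"
      then show "H \<in> core_family n k {1, 2} 2" using core[of H] sub[of A H] AB G by auto
    qed
    have le: "card \<F> \<le> S" "card \<G> \<le> S"
      using card_mono[OF finite_core_family FS] card_mono[OF finite_core_family GS] card_star by auto
    have "S * S \<le> card \<F> * card \<G>" using optimal_ge[OF opt] by (simp add: power2_eq_square)
    note factors_eq_max[OF this le S_pos]
    then have eq: "card \<F> = S" "card \<G> = S" by auto
    have "\<F> = core_family n k {1, 2} 2" "\<G> = core_family n k {1, 2} 2"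
      using card_subset_eq[OF finite_core_family FS] card_subset_eq[OF finite_core_family GS] eq card_star
      by auto
    then show ?thesis using eq by (simp add: power2_eq_square)
  qed
qed

lemma optimal_shift:
  assumes "optimal \<F> \<G>" "i \<in> {1..n}"
  shows "optimal (shift i j \<F>) (shift i j \<G>)"
proof -
  have FG: "\<F> \<subseteq> nsets {1..n} k" "\<G> \<subseteq> nsets {1..n} k" and X: "cross_intersecting 2 \<F> \<G>"
    using assms(1) unfolding optimal_def by blast+
  have fin: "finite A" if "A \<in> \<F> \<union> \<G>" for A
  proof -
    have "A \<in> nsets {1..n} k" using that FG by blast
    then show ?thesis by (simp add: nsets_def)
  qed
  have "cross_intersecting 2 (shift i j \<F>) (shift i j \<G>)"
    by (rule cross_intersecting_shift[OF X fin])
  then show ?thesis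
    using assms(1) shift_subset_nsets[OF FG(1) assms(2)] shift_subset_nsets[OF FG(2) assms(2)]
    unfolding optimal_def card_shift by simp
qed

text \<open>Induction on the total weight: a proper shift lowers it and keeps the pair optimal. The
  clause \<open>3 \<le> k\<close> is carried along because undoing a shift at threshold 3 requires
  \<open>r \<le> k\<close>.\<close>

lemma optimal_structure:
  assumes "optimal \<F> \<G>"
  shows "card \<F> * card \<G> = S\<^sup>2 \<and>
    ((\<exists>T \<in> nsets {1..n} 2. \<F> = core_family n k T 2 \<and> \<G> = core_family n k T 2) \<or>
     3 \<le> k \<and> n = 3 * (k - 1) \<and>
     (\<exists>T \<in> nsets {1..n} 4. \<F> = core_family n k T 3 \<and> \<G> = core_family n k T 3))"
  using assms
proof (induction "weight \<F> + weight \<G>" arbitrary: \<F> \<G> rule: less_induct)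
  case less
  note opt = less.prems
  have F: "\<F> \<subseteq> nsets {1..n} k" and G: "\<G> \<subseteq> nsets {1..n} k" and crs: "cross_intersecting 2 \<F> \<G>"
    using opt by (auto simp: optimal_def)
  have fin: "finite \<F>" "finite \<G>"
    using finite_subset[OF F] finite_subset[OF G] by (simp_all add: finite_imp_finite_nsets)
  have mem: "finite A" "A \<subseteq> {1..n}" if "A \<in> \<F> \<union> \<G>" for A
  proof -
    have "A \<in> nsets {1..n} k" using that F G by blast
    then show "finite A" "A \<subseteq> {1..n}" by (simp_all add: nsets_def)
  qed
  show ?case
  proof (cases "shifted \<F> \<and> shifted \<G>")
    case True
    have "{1, 2} \<in> nsets {1..n} 2" "3 \<le> k \<Longrightarrow> n = 3 * (k - 1) \<Longrightarrow> {1..4} \<in> nsets {1..n} 4"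
      using n_ge by (auto simp: nsets_def)
    then show ?thesis using optimal_shifted[OF opt] True by blast
  next
    case False
    then obtain \<H> A i j where H: "\<H> = \<F> \<or> \<H> = \<G>" "A \<in> \<H>" "1 \<le> i" "i < j" "j \<in> A" "i \<notin> A" "swap_in i j A \<notin> \<H>"
      unfolding shifted_def by blast
    then have "A \<subseteq> {1..n}" using mem by blast
    then have ij: "i \<in> {1..n}" "j \<in> {1..n}" using H by auto
    have "weight (shift i j \<F>) \<le> weight \<F>" "weight (shift i j \<G>) \<le> weight \<G>"
      using weight_shift_le[OF mem(1) H(4)] by simp_all
    moreover have "weight (shift i j \<H>) < weight \<H>"
      using H(1) fin mem(1) by (intro weight_shift_less[OF _ _ H(4,2,5,6,7)]) auto
    ultimately have "weight (shift i j \<F>) + weight (shift i j \<G>) < weight \<F> + weight \<G>"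
      using H(1) by auto
    from less.hyps[OF this optimal_shift[OF opt ij(1)]]
    have IH: "card \<F> * card \<G> = S\<^sup>2"
      "(\<exists>T \<in> nsets {1..n} 2. shift i j \<F> = core_family n k T 2 \<and> shift i j \<G> = core_family n k T 2) \<or>
       3 \<le> k \<and> n = 3 * (k - 1) \<and>
       (\<exists>T \<in> nsets {1..n} 4. shift i j \<F> = core_family n k T 3 \<and> shift i j \<G> = core_family n k T 3)"
      by (auto simp: card_shift)
    \<comment> \<open>The room required is \<open>2 + 1 + 3 * (k - 2) = 3 * (k - 1)\<close>, exactly
      the assumed lower bound on \<open>n\<close>.\<close>
    have two: "\<exists>T' \<in> nsets {1..n} 2. \<F> = core_family n k T' 2 \<and> \<G> = core_family n k T' 2"
      if "T \<in> nsets {1..n} 2" "shift i j \<F> = core_family n k T 2" "shift i j \<G> = core_family n k T 2" for T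
      by (rule unshift_core_family[OF crs F G that(2,3) ij that(1)]) (use k2 n3 in auto)
    \<comment> \<open>Here \<open>4 + 1 + 3 * (k - 3) = 3 * k - 4\<close> points suffice.\<close>
    have four: "\<exists>T' \<in> nsets {1..n} 4. \<F> = core_family n k T' 3 \<and> \<G> = core_family n k T' 3"
      if "3 \<le> k" "T \<in> nsets {1..n} 4" "shift i j \<F> = core_family n k T 3" "shift i j \<G> = core_family n k T 3" for T
      by (rule unshift_core_family[OF crs F G that(3,4) ij that(2)]) (use that(1) n3 in auto)
    show ?thesis using IH two four by blast
  qed
qed

lemma optimal_exists: "\<exists>\<F> \<G>. optimal \<F> \<G>"
proof -
  let ?P = "{(\<F>, \<G>). \<F> \<subseteq> nsets {1..n} k \<and> \<G> \<subseteq> nsets {1..n} k \<and> cross_intersecting 2 \<F> \<G>}"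
  let ?c = "\<lambda>(\<F>, \<G>). card \<F> * card \<G>"
  have "?P \<subseteq> Pow (nsets {1..n} k) \<times> Pow (nsets {1..n} k)" by auto
  then have fin: "finite ?P" by (rule finite_subset) (simp add: finite_imp_finite_nsets)
  have "({}, {}) \<in> ?P" by (simp add: cross_intersecting_def)
  then have "Max (?c ` ?P) \<in> ?c ` ?P" using fin by (intro Max_in) blast+
  then obtain \<F> \<G> where FG: "(\<F>, \<G>) \<in> ?P" "Max (?c ` ?P) = card \<F> * card \<G>" by auto
  have "card \<F>' * card \<G>' \<le> card \<F> * card \<G>" if "(\<F>', \<G>') \<in> ?P" for \<F>' \<G>'
    unfolding FG(2)[symmetric] using that fin by (intro Max_ge) force+
  then have "optimal \<F> \<G>" using FG(1) unfolding optimal_def by blast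
  then show ?thesis by blast
qed

end

theorem theorem1p3:
  fixes n k :: nat and \<F> \<G> :: "nat set set"
  assumes "k \<ge> 2" and "n \<ge> 3 * (k - 1)"
    and "\<F> \<subseteq> nsets {1..n} k" and "\<G> \<subseteq> nsets {1..n} k"
    and "cross_intersecting 2 \<F> \<G>"
  shows "card \<F> * card \<G> \<le> ((n - 2) choose (k - 2))\<^sup>2 \<and>
    (card \<F> * card \<G> = ((n - 2) choose (k - 2))\<^sup>2 \<longrightarrow>
      (n > 3 * (k - 1) \<longrightarrow>
        (\<exists>T \<in> nsets {1..n} 2. \<F> = star_family n k T \<and> \<G> = star_family n k T)) \<and>
      (n = 3 * (k - 1) \<longrightarrow>
        (\<exists>T \<in> nsets {1..n} 2. \<F> = star_family n k T \<and> \<G> = star_family n k T) \<or>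
        (\<exists>T' \<in> nsets {1..n} 4.
          \<F> = {F \<in> nsets {1..n} k. card (F \<inter> T') \<ge> 3} \<and>
          \<G> = {F \<in> nsets {1..n} k. card (F \<inter> T') \<ge> 3})))"
proof -
  interpret ekr_range n k by unfold_locales (use assms in auto)
  obtain \<F>0 \<G>0 where opt0: "optimal \<F>0 \<G>0" using optimal_exists by blast
  \<comment> \<open>Some optimal pair exists and its product is the square of \<open>S\<close>;
    hence this bounds every product, and a pair attaining it is itself optimal.\<close>
  then have max: "card \<F>' * card \<G>' \<le> S\<^sup>2"
    if "\<F>' \<subseteq> nsets {1..n} k" "\<G>' \<subseteq> nsets {1..n} k" "cross_intersecting 2 \<F>' \<G>'" for \<F>' \<G>'
    using optimal_structure[OF opt0] that unfolding optimal_def by metis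
  have "(\<exists>T \<in> nsets {1..n} 2. \<F> = star_family n k T \<and> \<G> = star_family n k T) \<or>
      n = 3 * (k - 1) \<and> (\<exists>T' \<in> nsets {1..n} 4. \<F> = core_family n k T' 3 \<and> \<G> = core_family n k T' 3)"
    if eq: "card \<F> * card \<G> = S\<^sup>2"
  proof -
    have "optimal \<F> \<G>" unfolding optimal_def eq using assms max by blast
    from optimal_structure[OF this] show ?thesis by (metis star_family_eq_core_family)
  qed
  then show ?thesis using max[OF assms(3-5)] unfolding core_family_def by auto
qed

end
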